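(* Let $\mathcal{H}=\mathcal{H}_A\otimes\mathcal{H}_B$ be a finite-dimensional bipartite Hilbert space and let $\rho$ be a state on $\mathcal{H}$. Then $$\mathcal{E}_{\max}(\rho)=E_R^\infty(\rho),$$ where $\mathcal{E}_{\max}(\rho):=\lim_{\varepsilon\to 0}\limsup_{n\to\infty}\frac{1}{n}E^{\varepsilon}_{\max}(\rho^{\otimes n})$ and $E_R^\infty(\rho):=\lim_{n\to\infty}\frac1n E_R(\rho^{\otimes n})$.
   Context: Logarithms are base 2. For $n\ge1$, $\mathcal{S}_n$ denotes the set of separable states on $\mathcal{H}^{\otimes n}=\mathcal{H}_A^{\otimes n}\otimes\mathcal{H}_B^{\otimes n}$ (separable with respect to the cut $A^n|B^n$). For a positive operator $\bar\rho$ (possibly subnormalized) and a positive operator $\sigma$ with $\mathrm{supp}\,\bar\rho\subseteq\mathrm{supp}\,\sigma$, the max-relative entropy is $D_{\max}(\bar\rho\|\sigma):=\log\min\{\lambda:\bar\rho\le\lambda\sigma\}$. For $\varepsilon\ge0$ and a state $\omega$, $B^\varepsilon(\omega):=\{\bar\omega\ge0:\|\bar\omega-\omega\|_1\le\varepsilon,\ \mathrm{Tr}\,\bar\omega\le\mathrm{Tr}\,\omega\}$, and $D^\varepsilon_{\max}(\omega\|\sigma):=\min_{\bar\omega\in B^\varepsilon(\omega)}D_{\max}(\bar\omega\|\sigma)$. The smooth max-relative entropy of entanglement of a state $\omega$ on $\mathcal{H}^{\otimes n}$ is $E^\varepsilon_{\max}(\omega):=\min_{\sigma\in\mathcal{S}_n}D^\varepsilon_{\max}(\omega\|\sigma)$.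 The relative entropy of entanglement is $E_R(\omega):=\min_{\sigma\in\mathcal{S}_n}S(\omega\|\sigma)$, with $S(\omega\|\sigma)=\mathrm{Tr}\,\omega(\log\omega-\log\sigma)$ the quantum relative entropy. *)

theory Defs
  imports "HOL-Analysis.Analysis" "Jordan_Normal_Form.Schur_Decomposition"
begin

definition mtrace :: "complex mat \<Rightarrow> complex" where
  "mtrace A = (\<Sum>i<dim_row A. A $$ (i,i))"

definition hermitian_mat :: "nat \<Rightarrow> complex mat \<Rightarrow> bool" where
  "hermitian_mat d A \<longleftrightarrow> A \<in> carrier_mat d d \<and> mat_adjoint A = A"

definition psd_mat :: "nat \<Rightarrow> complex mat \<Rightarrow> bool" where
  "psd_mat d A \<longleftrightarrow> hermitian_mat d A \<and>
     (\<forall>v\<in>carrier_vec d. 0 \<le> Re ((A *\<^sub>v v) \<bullet>c v))"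

definition mat_le :: "nat \<Rightarrow> complex mat \<Rightarrow> complex mat \<Rightarrow> bool" where
  "mat_le d A B \<longleftrightarrow> A \<in> carrier_mat d d \<and> B \<in> carrier_mat d d \<and> psd_mat d (B - A)"

definition state_mat :: "nat \<Rightarrow> complex mat \<Rightarrow> bool" where
  "state_mat d \<rho> \<longleftrightarrow> psd_mat d \<rho> \<and> mtrace \<rho> = 1"

definition unitary_mat :: "nat \<Rightarrow> complex mat \<Rightarrow> bool" where
  "unitary_mat d U \<longleftrightarrow> U \<in> carrier_mat d d \<and> U * mat_adjoint U = 1\<^sub>m d \<and> mat_adjoint U * U = 1\<^sub>m d"

definition spectral_decomp :: "nat \<Rightarrow> complex mat \<Rightarrow> complex mat \<times> (nat \<Rightarrow> real)" where
  "spectral_decomp d H = (SOME (U, lam). unitary_mat d U \<and>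
      H = U * mat_diag d (\<lambda>i. complex_of_real (lam i)) * mat_adjoint U)"

text \<open>Functional calculus f(H) for Hermitian H (independent of the chosen decomposition)\<close>
definition mat_fun :: "nat \<Rightarrow> (real \<Rightarrow> real) \<Rightarrow> complex mat \<Rightarrow> complex mat" where
  "mat_fun d f H = (case spectral_decomp d H of (U, lam) \<Rightarrow>
      U * mat_diag d (\<lambda>i. complex_of_real (f (lam i))) * mat_adjoint U)"

definition trace_norm :: "nat \<Rightarrow> complex mat \<Rightarrow> real" where
  "trace_norm d X = Re (mtrace (mat_fun d sqrt (mat_adjoint X * X)))"

definition kron :: "complex mat \<Rightarrow> complex mat \<Rightarrow> complex mat" where
  "kron A B = mat (dim_row A * dim_row B) (dim_col A * dim_col B)
     (\<lambda>(i,j). A $$ (i div dim_row B, j div dim_col B) * B $$ (i mod dim_row B, j mod dim_col B))"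

text \<open>support inclusion supp A \<subseteq> supp B, for Hermitian A, B: ker B \<subseteq> ker A\<close>
definition supp_le :: "nat \<Rightarrow> complex mat \<Rightarrow> complex mat \<Rightarrow> bool" where
  "supp_le d A B \<longleftrightarrow> (\<forall>v\<in>carrier_vec d. B *\<^sub>v v = 0\<^sub>v d \<longrightarrow> A *\<^sub>v v = 0\<^sub>v d)"

definition log2_supp :: "real \<Rightarrow> real" where
  "log2_supp x = (if x > 0 then log 2 x else 0)"

definition rel_entropy :: "nat \<Rightarrow> complex mat \<Rightarrow> complex mat \<Rightarrow> ereal" where
  "rel_entropy d w s = (if supp_le d w s then
      ereal (Re (mtrace (w * (mat_fun d log2_supp w - mat_fun d log2_supp s))))
    else \<infinity>)"

text \<open>max-relative entropy D_max(r||s) = log min{l : r \<le> l s}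
  (= +\<infinity> if no such l exists, = -\<infinity> if the minimum is 0, i.e. r = 0)\<close>
definition D_max :: "nat \<Rightarrow> complex mat \<Rightarrow> complex mat \<Rightarrow> ereal" where
  "D_max d r s = (INF l \<in> {l::real. l > 0 \<and> mat_le d r (complex_of_real l \<cdot>\<^sub>m s)}. ereal (log 2 l))"

definition smooth_ball :: "nat \<Rightarrow> real \<Rightarrow> complex mat \<Rightarrow> complex mat set" where
  "smooth_ball d \<epsilon> w = {wb. psd_mat d wb \<and> trace_norm d (wb - w) \<le> \<epsilon>
                                \<and> Re (mtrace wb) \<le> Re (mtrace w)}"

definition D_max_smooth :: "nat \<Rightarrow> real \<Rightarrow> complex mat \<Rightarrow> complex mat \<Rightarrow> ereal" where
  "D_max_smooth d \<epsilon> w s = (INF wb \<in> smooth_ball d \<epsilon> w. D_max d wb s)"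

text \<open>We represent H^{\<otimes>n} = H_A^{\<otimes>n} \<otimes> H_B^{\<otimes>n} with dimension dA^n * dB^n; basis index
  alpha * dB^n + beta, where alpha (resp. beta) encodes (a_1..a_n) (resp. (b_1..b_n)) in base dA
  (resp. dB). The single-copy space H_A \<otimes> H_B uses index a * dB + b.\<close>

definition digit :: "nat \<Rightarrow> nat \<Rightarrow> nat \<Rightarrow> nat" where
  "digit base k x = (x div base ^ k) mod base"

text \<open>rho^{\<otimes>n}, written in the ordering H_A^{\<otimes>n} \<otimes> H_B^{\<otimes>n}\<close>
definition tensor_pow :: "nat \<Rightarrow> nat \<Rightarrow> nat \<Rightarrow> complex mat \<Rightarrow> complex mat" where
  "tensor_pow dA dB n \<rho> = mat (dA ^ n * dB ^ n) (dA ^ n * dB ^ n)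
     (\<lambda>(i,j). \<Prod>k<n. \<rho> $$ (digit dA k (i div dB ^ n) * dB + digit dB k (i mod dB ^ n),
                          digit dA k (j div dB ^ n) * dB + digit dB k (j mod dB ^ n)))"

definition separable_states :: "nat \<Rightarrow> nat \<Rightarrow> nat \<Rightarrow> complex mat set" where
  "separable_states dA dB n = {\<sigma>. \<exists>(m::nat) (p::nat \<Rightarrow> real) \<sigma>A \<sigma>B.
      (\<forall>i<m. p i \<ge> 0 \<and> state_mat (dA ^ n) (\<sigma>A i) \<and> state_mat (dB ^ n) (\<sigma>B i)) \<and>
      (\<Sum>i<m. p i) = 1 \<and>
      \<sigma> = mat (dA ^ n * dB ^ n) (dA ^ n * dB ^ n)
             (\<lambda>(r,c). \<Sum>i<m. complex_of_real (p i) * kron (\<sigma>A i) (\<sigma>B i) $$ (r,c))}"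

definition E_max_smooth :: "nat \<Rightarrow> nat \<Rightarrow> nat \<Rightarrow> real \<Rightarrow> complex mat \<Rightarrow> ereal" where
  "E_max_smooth dA dB n \<epsilon> w =
     (INF \<sigma> \<in> separable_states dA dB n. D_max_smooth (dA ^ n * dB ^ n) \<epsilon> w \<sigma>)"

definition E_R :: "nat \<Rightarrow> nat \<Rightarrow> nat \<Rightarrow> complex mat \<Rightarrow> ereal" where
  "E_R dA dB n w = (INF \<sigma> \<in> separable_states dA dB n. rel_entropy (dA ^ n * dB ^ n) w \<sigma>)"

end

theory Submission
  imports Defs "Jordan_Normal_Form.Spectral_Radius"
begin

text \<open>
  Write \<open>a n = E_R(\<rho>\<^sup>n)\<close> and \<open>F \<epsilon> = limsup E_max^\<epsilon>(\<rho>\<^sup>n) / n\<close>, which increases as \<open>\<epsilon>\<close> decreases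
  to \<open>0\<close>. Two one-shot estimates squeeze \<open>limsup a n / n \<le> lim F \<le> liminf a n / n\<close>, so no separate
  subadditivity argument is needed.

  Lower bound on \<open>E_max\<close>: if a state \<open>w'\<close> is \<open>\<epsilon>\<close>-close to \<open>w\<close> and \<open>w' \<le> l s\<close>, then
  \<open>S(w || (s + I/D)/2) \<le> log l + O(\<epsilon> log D) + O(1)\<close>. In eigenbases the relative entropy is an average of
  \<open>log(w_i / s_j)\<close>; the inequality \<open>ln x \<le> x - 1\<close> together with \<open>w_i <u_i| s^-1 |u_i> \<le> l\<close> replaces
  operator monotonicity of the logarithm. Mixing with \<open>I/D\<close> makes all logarithms \<open>O(log D)\<close>, which
  turns trace-norm closeness into closeness of entropies.

  Upper bound on \<open>E_max\<close>: for separable \<open>s\<close> on \<open>m\<close> copies, project tensor powers of \<open>\<rho>\<^sup>m\<close> first onto its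
  own typical subspace and then onto that of the powers of \<open>(s + I/D)/2\<close>. Chebyshev's inequality
  and gentle measurement show that little is lost, and the projected operator is dominated by
  \<open>2^(k S + o(k))\<close> times a separable state. Hence \<open>F \<epsilon> \<le> (a m + 1) / m\<close> for every \<open>m\<close>.
\<close>

section \<open>Orthonormal bases and the spectral theorem\<close>

text \<open>In the lower bound, smoothing costs about 2 eps log(2 D), and log D is linear in the
  number of copies: this loss per copy survives n to infinity and disappears only when eps tends to
  0 afterwards. The other losses are a bounded number of bits and vanish on division by n. Mixing
  with I/D costs one such bit, since s is at most twice the mixture, and stays separable because I/D
  is a product of local maximally mixed states. In the upper bound a separable s need not commute
  with the tensor power of rho, so two classical distributions are tracked: the eigenvalues of the
  power, and its diagonal in the eigenbasis of s. The means of the corresponding log-eigenvalues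
  differ by the relative entropy. Means and variances add under tensor products, so Chebyshev's
  ratio V/t^2 with t proportional to n tends to 0. Copies that do not fill a block receive a fixed
  separable state. Entropies are handled through eigenbases, with the overlaps |<u_i, v_j>|^2 as
  doubly stochastic weights. As \<open>mat_fun\<close> rests on a choice of eigenbasis, independence
  of that choice has to be settled beforehand.\<close>

definition cip :: "nat \<Rightarrow> (nat \<Rightarrow> complex) \<Rightarrow> (nat \<Rightarrow> complex) \<Rightarrow> complex" where
  "cip d x y = (\<Sum>a<d. cnj (x a) * y a)"

definition nrm2 :: "nat \<Rightarrow> (nat \<Rightarrow> complex) \<Rightarrow> real" where
  "nrm2 d x = (\<Sum>a<d. (cmod (x a))\<^sup>2)"

definition orthon :: "nat \<Rightarrow> nat \<Rightarrow> (nat \<Rightarrow> nat \<Rightarrow> complex) \<Rightarrow> bool" where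
  "orthon k d u \<longleftrightarrow> (\<forall>i<k. \<forall>j<k. cip d (u i) (u j) = of_bool (i = j))"

text \<open>The second condition is the resolution of the identity, the form in which
  \<open>onb_expand\<close> and the Parseval identities consume completeness.\<close>

definition onb :: "nat \<Rightarrow> (nat \<Rightarrow> nat \<Rightarrow> complex) \<Rightarrow> bool" where
  "onb d u \<longleftrightarrow> orthon d d u \<and>
     (\<forall>a<d. \<forall>b<d. (\<Sum>i<d. u i a * cnj (u i b)) = of_bool (a = b))"

lemma cip_sum_right: "cip d x (\<lambda>a. \<Sum>i\<in>I. c i * f i a) = (\<Sum>i\<in>I. c i * cip d x (f i))"
  unfolding cip_def sum_distrib_left sum_distrib_right
  by (subst sum.swap) (simp add: mult_ac)

lemma cip_sum_left: "cip d (\<lambda>a. \<Sum>i\<in>I. c i * f i a) y = (\<Sum>i\<in>I. cnj (c i) * cip d (f i) y)"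
  unfolding cip_def sum_distrib_left sum_distrib_right cnj_sum
  by (subst sum.swap) (simp add: mult_ac)

lemma cip_diff_right: "cip d x (\<lambda>a. f a - g a) = cip d x f - cip d x g"
  by (simp add: cip_def algebra_simps sum_subtractf)

lemma cip_scale_right: "cip d x (\<lambda>a. c * f a) = c * cip d x f"
  by (simp add: cip_def sum_distrib_left mult_ac)

lemma cip_scale_left: "cip d (\<lambda>a. c * f a) y = cnj c * cip d f y"
  by (simp add: cip_def sum_distrib_left mult_ac)

lemma cip_cnj: "cnj (cip d x y) = cip d y x"
  by (simp add: cip_def mult_ac)

lemma cip_self: "cip d x x = of_real (nrm2 d x)"
  unfolding cip_def nrm2_def of_real_sum complex_norm_square by (simp add: mult.commute)

lemma cip_cong: "(\<And>a. a < d \<Longrightarrow> x a = x' a) \<Longrightarrow> (\<And>a. a < d \<Longrightarrow> y a = y' a) \<Longrightarrow> cip d x y = cip d x' y'"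
  by (simp add: cip_def)

lemma cip_delta: "a < d \<Longrightarrow> cip d x (\<lambda>b. of_bool (b = a)) = cnj (x a)"
  unfolding cip_def by (subst sum.remove[of _ a]) auto

lemma nrm2_nonneg: "nrm2 d x \<ge> 0"
  by (simp add: nrm2_def sum_nonneg)

lemma nrm2_eq_0_iff: "nrm2 d x = 0 \<longleftrightarrow> (\<forall>a<d. x a = 0)"
  unfolding nrm2_def by (subst sum_nonneg_eq_0_iff) auto

lemma cip_normalize:
  assumes "nrm2 d x \<noteq> 0"
  defines "y \<equiv> (\<lambda>a. of_real (1 / sqrt (nrm2 d x)) * x a)"
  shows "cip d y y = 1"
proof -
  have "nrm2 d x > 0" using assms nrm2_nonneg[of d x] by simp
  then show ?thesis
    unfolding y_def cip_scale_left cip_scale_right cip_self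
    by (simp flip: of_real_mult add: field_simps)
qed

lemma orthonD: "orthon k d u \<Longrightarrow> i < k \<Longrightarrow> j < k \<Longrightarrow> cip d (u i) (u j) = of_bool (i = j)"
  by (auto simp: orthon_def)

lemma sum_of_bool_mult: "i < (k::nat) \<Longrightarrow> (\<Sum>j<k. f j * of_bool (i = j)) = (f i :: complex)"
  by (subst sum.remove[of _ i]) auto

text \<open>Some standard basis vector has a nonzero component orthogonal to the given vectors,
  since otherwise summing the diagonal of the projection would give \<open>k = d\<close>.\<close>

lemma orthon_extend_one:
  assumes o: "orthon k d u" and "k < d"
  shows "\<exists>x. orthon (Suc k) d (u(k := x))"
proof -
  define y where "y a = (\<lambda>b. of_bool (b = a) - (\<Sum>i<k. cnj (u i a) * u i b))" for a
  have orth: "cip d (u i) (y a) = 0" if "i < k" "a < d" for i a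
  proof -
    have "(\<Sum>j<k. cnj (u j a) * cip d (u i) (u j)) = (\<Sum>j<k. cnj (u j a) * of_bool (i = j))"
      using that by (intro sum.cong refl) (simp add: orthonD[OF o])
    also have "\<dots> = cnj (u i a)" using that by (intro sum_of_bool_mult)
    finally show ?thesis
      unfolding y_def cip_diff_right cip_sum_right using that by (simp add: cip_delta)
  qed
  have "\<exists>a<d. nrm2 d (y a) \<noteq> 0"
  proof (rule ccontr)
    assume "\<not> ?thesis"
    then have "y a a = 0" if "a < d" for a using that by (auto simp: nrm2_eq_0_iff)
    then have "(\<Sum>i<k. cnj (u i a) * u i a) = 1" if "a < d" for a
      using that unfolding y_def by simp
    then have "(\<Sum>a<d. \<Sum>i<k. cnj (u i a) * u i a) = of_nat d" by simp
    moreover have "(\<Sum>a<d. \<Sum>i<k. cnj (u i a) * u i a) = (\<Sum>i<k. cip d (u i) (u i))"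
      unfolding cip_def by (rule sum.swap)
    moreover have "\<dots> = of_nat k" using orthonD[OF o] by simp
    ultimately show False using \<open>k < d\<close> by (metis of_nat_eq_iff less_irrefl)
  qed
  then obtain a where a: "a < d" "nrm2 d (y a) \<noteq> 0" by blast
  define x where "x = (\<lambda>b. of_real (1 / sqrt (nrm2 d (y a))) * y a b)"
  have xx: "cip d x x = 1" unfolding x_def by (rule cip_normalize[OF a(2)])
  have ux: "cip d (u i) x = 0" if "i < k" for i
    unfolding x_def cip_scale_right using orth[OF that a(1)] by simp
  have xu: "cip d x (u i) = 0" if "i < k" for i
    using cip_cnj[of d "u i" x] ux[OF that] by simp
  have "orthon (Suc k) d (u(k := x))"
    using xx ux xu orthonD[OF o] by (auto simp: orthon_def less_Suc_eq)
  then show ?thesis by blast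
qed

lemma orthon_extend:
  assumes "orthon k d u" "k \<le> d"
  shows "\<exists>u'. orthon d d u' \<and> (\<forall>i<k. u' i = u i)"
proof -
  have "k \<le> n \<Longrightarrow> n \<le> d \<Longrightarrow> \<exists>u'. orthon n d u' \<and> (\<forall>i<k. u' i = u i)" for n
  proof (induction n)
    case 0
    then show ?case using assms by auto
  next
    case (Suc n)
    show ?case
    proof (cases "k = Suc n")
      case True
      then show ?thesis using assms by auto
    next
      case False
      with Suc obtain u' where u': "orthon n d u'" "\<forall>i<k. u' i = u i" by auto
      from orthon_extend_one[OF u'(1)] Suc obtain x where "orthon (Suc n) d (u'(n := x))" by auto
      moreover have "\<forall>i<k. (u'(n := x)) i = u i" using u'(2) False Suc.prems by auto
      ultimately show ?thesis by blast
    qed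
  qed
  then show ?thesis using assms by blast
qed

text \<open>With the vectors as columns of a square matrix \<open>U\<close>, orthonormality says
  that its adjoint \<open>V\<close> is a left inverse. It is then also a right inverse, and the
  entries of \<open>U * V\<close> give the completeness relation.\<close>

lemma orthon_imp_onb:
  assumes o: "orthon d d u"
  shows "onb d u"
proof -
  define U where "U = Matrix.mat d d (\<lambda>(a,i). u i a)"
  define V where "V = Matrix.mat d d (\<lambda>(i,a). cnj (u i a))"
  have U: "U \<in> carrier_mat d d" and V: "V \<in> carrier_mat d d" by (auto simp: U_def V_def)
  have "V * U = 1\<^sub>m d"
  proof (rule eq_matI)
    fix i j assume ij: "i < dim_row (1\<^sub>m d :: complex mat)" "j < dim_col (1\<^sub>m d :: complex mat)"
    then have "(V * U) $$ (i,j) = cip d (u i) (u j)"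
      by (simp add: U_def V_def scalar_prod_def cip_def atLeast0LessThan)
    then show "(V * U) $$ (i,j) = 1\<^sub>m d $$ (i,j)" using ij orthonD[OF o, of i j] by simp
  qed (auto simp: U_def V_def)
  then have UV: "U * V = 1\<^sub>m d" using mat_mult_left_right_inverse[OF V U] by simp
  have "(\<Sum>i<d. u i a * cnj (u i b)) = of_bool (a = b)" if "a < d" "b < d" for a b
  proof -
    have "(U * V) $$ (a,b) = (\<Sum>i<d. u i a * cnj (u i b))"
      using that by (simp add: U_def V_def scalar_prod_def atLeast0LessThan)
    then show ?thesis using that by (simp add: UV split: if_splits)
  qed
  then show ?thesis using o by (auto simp: onb_def)
qed

lemma onbD: "onb d u \<Longrightarrow> i < d \<Longrightarrow> j < d \<Longrightarrow> cip d (u i) (u j) = of_bool (i = j)"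
  by (auto simp: onb_def orthon_def)

lemma onb_complete:
  "onb d u \<Longrightarrow> a < d \<Longrightarrow> b < d \<Longrightarrow> (\<Sum>i<d. u i a * cnj (u i b)) = of_bool (a = b)"
  by (auto simp: onb_def)

lemma onb_expand:
  assumes "onb d u" "a < d"
  shows "x a = (\<Sum>i<d. cip d (u i) x * u i a)"
proof -
  have "(\<Sum>i<d. cip d (u i) x * u i a) = (\<Sum>b<d. (\<Sum>i<d. u i a * cnj (u i b)) * x b)"
    unfolding cip_def sum_distrib_right by (subst sum.swap) (simp add: mult_ac)
  also have "\<dots> = (\<Sum>b<d. x b * of_bool (a = b))"
    using assms by (intro sum.cong refl) (simp add: onb_complete)
  also have "\<dots> = x a" using assms by (intro sum_of_bool_mult)
  finally show ?thesis by simp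
qed

lemma onb_parseval_cip:
  assumes u: "onb d u"
  shows "cip d x y = (\<Sum>i<d. cnj (cip d (u i) x) * cip d (u i) y)"
proof -
  have "cip d x y = cip d (\<lambda>a. \<Sum>i<d. cip d (u i) x * u i a) y"
    by (intro cip_cong onb_expand[OF u] refl)
  also have "\<dots> = (\<Sum>i<d. cnj (cip d (u i) x) * cip d (u i) y)" by (rule cip_sum_left)
  finally show ?thesis .
qed

lemma onb_parseval:
  assumes u: "onb d u"
  shows "(\<Sum>i<d. (cmod (cip d (u i) x))\<^sup>2) = nrm2 d x"
proof -
  have "complex_of_real (nrm2 d x) = of_real (\<Sum>i<d. (cmod (cip d (u i) x))\<^sup>2)"
    unfolding cip_self[symmetric] onb_parseval_cip[OF u, of x x]
    unfolding of_real_sum complex_norm_square by (simp add: mult.commute)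
  then show ?thesis by (metis of_real_eq_iff)
qed

lemma nrm2_onb: "onb d u \<Longrightarrow> i < d \<Longrightarrow> nrm2 d (u i) = 1"
  using onbD[of d u i i] cip_self[of d "u i"] by simp

section \<open>Diagonalization of Hermitian matrices\<close>

definition mv :: "nat \<Rightarrow> (nat \<Rightarrow> nat \<Rightarrow> complex) \<Rightarrow> (nat \<Rightarrow> complex) \<Rightarrow> nat \<Rightarrow> complex" where
  "mv d A x a = (\<Sum>b<d. A a b * x b)"

lemma mv_sum: "mv d A (\<lambda>b. \<Sum>i\<in>I. c i * f i b) a = (\<Sum>i\<in>I. c i * mv d A (f i) a)"
  unfolding mv_def sum_distrib_left sum_distrib_right
  by (subst sum.swap) (simp add: mult_ac)

lemma mv_scale: "mv d A (\<lambda>b. c * x b) a = c * mv d A x a"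
  by (simp add: mv_def sum_distrib_left mult_ac)

lemma cip_mv_hermitian:
  assumes "\<And>a b. a < d \<Longrightarrow> b < d \<Longrightarrow> A b a = cnj (A a b)"
  shows "cip d x (mv d A y) = cip d (mv d A x) y"
proof -
  have "cip d x (mv d A y) = (\<Sum>a<d. \<Sum>b<d. cnj (x a) * A a b * y b)"
    by (simp add: cip_def mv_def sum_distrib_left mult_ac)
  also have "\<dots> = (\<Sum>b<d. \<Sum>a<d. cnj (x a) * cnj (A b a) * y b)"
  proof (subst sum.swap, intro sum.cong refl)
    fix a b assume "a \<in> {..<d}" "b \<in> {..<d}"
    then have "A b a = cnj (A a b)" using assms by blast
    then show "cnj (x b) * A b a * y a = cnj (x b) * cnj (A a b) * y a" by simp
  qed
  also have "\<dots> = cip d (mv d A x) y"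
    by (simp add: cip_def mv_def sum_distrib_left sum_distrib_right mult_ac)
  finally show ?thesis .
qed

lemma eigenvector_ex:
  assumes "d > 0"
  shows "\<exists>x k. cip d x x = 1 \<and> (\<forall>a<d. mv d A x a = k * x a)"
proof -
  define M where "M = Matrix.mat d d (\<lambda>(a,b). A a b)"
  have M: "M \<in> carrier_mat d d" by (simp add: M_def)
  from spectrum_non_empty[OF M] assms obtain k where "eigenvalue M k"
    by (auto simp: spectrum_def)
  then obtain v where v: "v \<in> carrier_vec d" "v \<noteq> 0\<^sub>v d" "M *\<^sub>v v = k \<cdot>\<^sub>v v"
    using M by (auto simp: eigenvalue_def eigenvector_def)
  define x where "x a = v $ a" for a
  have ev: "mv d A x a = k * x a" if "a < d" for a
  proof -
    have "(M *\<^sub>v v) $ a = mv d A x a"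
      using that v(1) by (simp add: M_def scalar_prod_def mv_def x_def atLeast0LessThan)
    then show ?thesis using v that by (simp add: x_def)
  qed
  have "nrm2 d x \<noteq> 0"
    using v(1,2) by (auto simp: nrm2_eq_0_iff x_def)
  from cip_normalize[OF this] ev show ?thesis
    by (intro exI[of _ "\<lambda>a. of_real (1 / sqrt (nrm2 d x)) * x a"] exI[of _ k])
       (simp add: mv_scale del: of_real_divide)
qed

text \<open>Induction by deflation. A unit eigenvector \<open>x\<close> is completed to an
  orthonormal basis \<open>u\<close>; compressing \<open>A\<close> to the span of the remaining
  vectors gives a Hermitian matrix \<open>A'\<close> of size \<open>d\<close>, whose eigenvectors,
  read as coordinates in that basis, supply the others.\<close>

lemma hermitian_eigenbasis:
  assumes "\<And>a b. a < d \<Longrightarrow> b < d \<Longrightarrow> A b a = cnj (A a b)"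
  shows "\<exists>u (lam :: nat \<Rightarrow> real). onb d u \<and> (\<forall>i<d. \<forall>a<d. mv d A (u i) a = of_real (lam i) * u i a)"
  using assms
proof (induction d arbitrary: A)
  case 0
  then show ?case by (auto simp: onb_def orthon_def)
next
  case (Suc d)
  let ?D = "Suc d"
  note herm = cip_mv_hermitian[of ?D A, OF Suc.prems]
  obtain x k where x: "cip ?D x x = 1" "\<And>a. a < ?D \<Longrightarrow> mv ?D A x a = k * x a"
    using eigenvector_ex[of ?D A] by auto
  \<comment> \<open>Evaluating both sides of self-adjointness at the unit eigenvector shows that its
    eigenvalue is real.\<close>
  have "cip ?D x (mv ?D A x) = cip ?D x (\<lambda>a. k * x a)" "cip ?D (mv ?D A x) x = cip ?D (\<lambda>a. k * x a) x"
    by (auto intro!: cip_cong x)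
  with herm[of x x] x(1) have "k = cnj k" by (simp add: cip_scale_left cip_scale_right)
  then have k: "k = of_real (Re k)" by (simp add: complex_eq_iff)
  have "orthon 1 ?D (\<lambda>_. x)" using x(1) by (auto simp: orthon_def)
  from orthon_extend[OF this] obtain u where u: "orthon ?D ?D u" "u 0 = x" by auto
  then have onb: "onb ?D u" using orthon_imp_onb by blast
  define A' where "A' i j = cip ?D (u (Suc i)) (mv ?D A (u (Suc j)))" for i j
  have "A' j i = cnj (A' i j)" for i j
    unfolding A'_def cip_cnj by (rule herm)
  from Suc.IH[of A', OF this] obtain w and mu :: "nat \<Rightarrow> real" where w: "onb d w"
    and "\<forall>i<d. \<forall>a<d. mv d A' (w i) a = of_real (mu i) * w i a" by blast
  then have mu: "\<And>i a. i < d \<Longrightarrow> a < d \<Longrightarrow> mv d A' (w i) a = of_real (mu i) * w i a" by blast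
  define v where "v i = (case i of 0 \<Rightarrow> x | Suc i \<Rightarrow> (\<lambda>a. \<Sum>j<d. w i j * u (Suc j) a))" for i
  have xu: "cip ?D x (u (Suc j)) = 0" if "j < d" for j
    using onbD[OF onb, of 0 "Suc j"] u that by simp
  have xv: "cip ?D x (v (Suc i)) = 0" if "i < d" for i
    unfolding v_def using that xu by (simp add: cip_sum_right)
  have uv: "cip ?D (u (Suc l)) (v (Suc i)) = w i l" if "i < d" "l < d" for i l
  proof -
    have "cip ?D (u (Suc l)) (v (Suc i)) = (\<Sum>j<d. w i j * cip ?D (u (Suc l)) (u (Suc j)))"
      by (simp add: v_def cip_sum_right)
    also have "\<dots> = (\<Sum>j<d. w i j * of_bool (l = j))"
      using onbD[OF onb] that by (intro sum.cong refl) auto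
    finally show ?thesis using sum_of_bool_mult[OF that(2)] by simp
  qed
  have vv: "cip ?D (v (Suc i)) (v (Suc j)) = of_bool (i = j)" if "i < d" "j < d" for i j
  proof -
    have "cip ?D (v (Suc i)) (v (Suc j)) = (\<Sum>l<d. cnj (w i l) * cip ?D (u (Suc l)) (v (Suc j)))"
      by (simp add: v_def[of "Suc i"] cip_sum_left)
    also have "\<dots> = cip d (w i) (w j)"
      using uv that by (simp add: cip_def)
    finally show ?thesis using onbD[OF w that] by simp
  qed
  have "orthon ?D ?D v"
    unfolding orthon_def
  proof (intro allI impI)
    fix i j assume ij: "i < ?D" "j < ?D"
    show "cip ?D (v i) (v j) = of_bool (i = j)"
    proof (cases i)
      case i0: 0
      then show ?thesis using x(1) xv ij by (cases j) (auto simp: v_def[of 0])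
    next
      case i: (Suc i')
      then show ?thesis
      proof (cases j)
        case 0
        have "cip ?D (v i) x = cnj (cip ?D x (v i))" by (simp add: cip_cnj)
        then show ?thesis using xv[of i'] i ij 0 by (simp add: v_def[of 0])
      qed (use vv ij i in auto)
    qed
  qed
  then have "onb ?D v" by (rule orthon_imp_onb)
  moreover have "mv ?D A (v i) a = of_real (case i of 0 \<Rightarrow> Re k | Suc i \<Rightarrow> mu i) * v i a"
    if "i < ?D" "a < ?D" for i a
  proof (cases i)
    case 0
    then show ?thesis using x(2)[OF that(2)] k by (simp add: v_def)
  next
    case (Suc i')
    then have i': "i' < d" using that by simp
    define y where "y = mv ?D A (v (Suc i'))"
    \<comment> \<open>Moving \<open>A\<close> onto the eigenvector \<open>x\<close> shows that the
      complement of \<open>x\<close> is invariant, so \<open>y\<close> has no component along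
      \<open>u 0\<close>.\<close>
    have "cip ?D x y = cip ?D (mv ?D A x) (v (Suc i'))"
      unfolding y_def by (rule herm)
    also have "\<dots> = cip ?D (\<lambda>a. k * x a) (v (Suc i'))"
      by (intro cip_cong x(2) refl)
    finally have y0: "cip ?D x y = 0" using xv[OF i'] by (simp add: cip_scale_left)
    have yS: "cip ?D (u (Suc l)) y = of_real (mu i') * w i' l" if "l < d" for l
    proof -
      have "y b = (\<Sum>j<d. w i' j * mv ?D A (u (Suc j)) b)" for b
        unfolding y_def v_def by (simp add: mv_sum)
      then have "cip ?D (u (Suc l)) y = (\<Sum>j<d. w i' j * A' l j)"
        unfolding A'_def cip_sum_right[symmetric] by (intro cip_cong) auto
      also have "\<dots> = mv d A' (w i') l" by (simp add: mv_def mult.commute)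
      finally show ?thesis using mu[OF i' that] by simp
    qed
    have "y a = (\<Sum>i<?D. cip ?D (u i) y * u i a)" by (rule onb_expand[OF onb that(2)])
    also have "\<dots> = (\<Sum>l<d. cip ?D (u (Suc l)) y * u (Suc l) a)"
      by (subst sum.lessThan_Suc_shift) (simp add: u(2) y0)
    also have "\<dots> = of_real (mu i') * v (Suc i') a"
      using yS by (simp add: v_def sum_distrib_left mult_ac)
    finally show ?thesis using Suc by (simp add: y_def)
  qed
  ultimately show ?case by blast
qed

section \<open>Quadratic forms and functional calculus\<close>

text \<open>The real part of <x, A x>, which is the whole value when \<open>A\<close> is Hermitian.
  Order, trace and relative entropy are all read off from these numbers.\<close>

definition qf :: "nat \<Rightarrow> complex mat \<Rightarrow> (nat \<Rightarrow> complex) \<Rightarrow> real" where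
  "qf d A x = Re (\<Sum>a<d. \<Sum>b<d. cnj (x a) * A $$ (a,b) * x b)"

text \<open>A relation rather than a function: any eigenbasis may be supplied, whereas
  \<open>spectral_decomp\<close> fixes one by choice.\<close>

definition spec :: "nat \<Rightarrow> complex mat \<Rightarrow> (nat \<Rightarrow> nat \<Rightarrow> complex) \<Rightarrow> (nat \<Rightarrow> real) \<Rightarrow> bool" where
  "spec d A u lam \<longleftrightarrow> A \<in> carrier_mat d d \<and> onb d u \<and>
     (\<forall>a<d. \<forall>b<d. A $$ (a,b) = (\<Sum>i<d. of_real (lam i) * u i a * cnj (u i b)))"

lemma mat_adjoint_carrier: "A \<in> carrier_mat n m \<Longrightarrow> mat_adjoint A \<in> carrier_mat m n"
  by (auto simp: mat_adjoint_def)

lemma mat_adjoint_index: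
  assumes "A \<in> carrier_mat n m" "i < m" "j < n"
  shows "mat_adjoint A $$ (i,j) = cnj (A $$ (j,i))"
  using assms by (auto simp: mat_adjoint_def mat_of_rows_def vec_of_list_index)

lemma hermitian_mat_iff:
  "hermitian_mat d A \<longleftrightarrow> A \<in> carrier_mat d d \<and> (\<forall>a<d. \<forall>b<d. A $$ (b,a) = cnj (A $$ (a,b)))"
  (is "?L \<longleftrightarrow> ?R")
proof
  assume ?L
  then have A: "A \<in> carrier_mat d d" and eq: "mat_adjoint A = A" by (auto simp: hermitian_mat_def)
  then show ?R using mat_adjoint_index[OF A] by metis
next
  assume R: ?R
  then have A: "A \<in> carrier_mat d d" by blast
  have "mat_adjoint A = A"
  proof (rule eq_matI)
    fix i j assume "i < dim_row A" "j < dim_col A"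
    then have ij: "i < d" "j < d" using A by auto
    then have "A $$ (i,j) = cnj (A $$ (j,i))" using R by blast
    then show "mat_adjoint A $$ (i,j) = A $$ (i,j)" using mat_adjoint_index[OF A ij] by simp
  qed (use A mat_adjoint_carrier[OF A] in auto)
  then show ?L using A by (auto simp: hermitian_mat_def)
qed

lemma hermitian_carrier: "hermitian_mat d A \<Longrightarrow> A \<in> carrier_mat d d"
  by (simp add: hermitian_mat_def)

lemma hermitian_diff:
  assumes "hermitian_mat d A" "hermitian_mat d B"
  shows "hermitian_mat d (A - B)"
proof -
  have c: "A \<in> carrier_mat d d" "B \<in> carrier_mat d d" using assms by (auto simp: hermitian_mat_def)
  have "cnj ((A - B) $$ (a,b)) = (A - B) $$ (b,a)" if "a < d" "b < d" for a b
  proof -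
    have "A $$ (b,a) = cnj (A $$ (a,b))" "B $$ (b,a) = cnj (B $$ (a,b))"
      using assms that unfolding hermitian_mat_iff by blast+
    then show ?thesis using c that by simp
  qed
  then show ?thesis using c unfolding hermitian_mat_iff by auto
qed

lemma hermitian_smult:
  assumes "hermitian_mat d A"
  shows "hermitian_mat d (complex_of_real c \<cdot>\<^sub>m A)"
proof -
  have c: "A \<in> carrier_mat d d" using assms by (auto simp: hermitian_mat_def)
  have "cnj ((complex_of_real c \<cdot>\<^sub>m A) $$ (a,b)) = (complex_of_real c \<cdot>\<^sub>m A) $$ (b,a)"
    if "a < d" "b < d" for a b
  proof -
    have "A $$ (b,a) = cnj (A $$ (a,b))" using assms that unfolding hermitian_mat_iff by blast
    then show ?thesis using c that by simp
  qed
  then show ?thesis using c unfolding hermitian_mat_iff by (auto simp del: index_smult_mat(1))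
qed

lemma qf_vec:
  assumes A: "A \<in> carrier_mat d d" and v: "v \<in> carrier_vec d"
  shows "Re ((A *\<^sub>v v) \<bullet>c v) = qf d A (\<lambda>a. v $ a)"
proof -
  have "(A *\<^sub>v v) \<bullet>c v = (\<Sum>a<d. (\<Sum>b<d. A $$ (a,b) * v $ b) * cnj (v $ a))"
    using A v by (simp add: scalar_prod_def atLeast0LessThan)
  also have "\<dots> = (\<Sum>a<d. \<Sum>b<d. cnj (v $ a) * A $$ (a,b) * v $ b)"
    by (simp add: sum_distrib_left sum_distrib_right mult_ac)
  finally show ?thesis by (simp add: qf_def)
qed

lemma qf_cong: "(\<And>a. a < d \<Longrightarrow> x a = y a) \<Longrightarrow> qf d A x = qf d A y"
  by (simp add: qf_def)

lemma psd_mat_iff: "psd_mat d A \<longleftrightarrow> hermitian_mat d A \<and> (\<forall>x. qf d A x \<ge> 0)"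
proof (cases "hermitian_mat d A")
  case True
  then have A: "A \<in> carrier_mat d d" by (rule hermitian_carrier)
  have "(\<forall>v\<in>carrier_vec d. 0 \<le> Re ((A *\<^sub>v v) \<bullet>c v)) \<longleftrightarrow> (\<forall>x. qf d A x \<ge> 0)"
  proof safe
    fix x assume *: "\<forall>v\<in>carrier_vec d. 0 \<le> Re ((A *\<^sub>v v) \<bullet>c v)"
    have "qf d A (\<lambda>a. Matrix.vec d x $ a) \<ge> 0"
      using * qf_vec[OF A, of "Matrix.vec d x"] by (metis vec_carrier)
    also have "qf d A (\<lambda>a. Matrix.vec d x $ a) = qf d A x" by (intro qf_cong) simp
    finally show "qf d A x \<ge> 0" .
  next
    fix v :: "complex vec" assume "\<forall>x. qf d A x \<ge> 0" "v \<in> carrier_vec d"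
    then show "0 \<le> Re ((A *\<^sub>v v) \<bullet>c v)" using qf_vec[OF A] by metis
  qed
  with True show ?thesis by (simp add: psd_mat_def)
qed (simp add: psd_mat_def)

lemma qf_diff:
  assumes "A \<in> carrier_mat d d" "B \<in> carrier_mat d d"
  shows "qf d (A - B) x = qf d A x - qf d B x"
proof -
  have "(\<Sum>a<d. \<Sum>b<d. cnj (x a) * (A - B) $$ (a,b) * x b) =
    (\<Sum>a<d. \<Sum>b<d. cnj (x a) * A $$ (a,b) * x b - cnj (x a) * B $$ (a,b) * x b)"
    using assms by (intro sum.cong refl) (auto simp: algebra_simps)
  then show ?thesis by (simp add: qf_def sum_subtractf)
qed

lemma qf_smult:
  assumes "A \<in> carrier_mat d d"
  shows "qf d (complex_of_real c \<cdot>\<^sub>m A) x = c * qf d A x"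
proof -
  have "(\<Sum>a<d. \<Sum>b<d. cnj (x a) * (complex_of_real c \<cdot>\<^sub>m A) $$ (a,b) * x b) =
    of_real c * (\<Sum>a<d. \<Sum>b<d. cnj (x a) * A $$ (a,b) * x b)"
    unfolding sum_distrib_left
    using assms by (intro sum.cong refl) (auto simp: algebra_simps)
  then show ?thesis by (simp add: qf_def)
qed

lemma mat_le_iff:
  assumes "hermitian_mat d A" "hermitian_mat d B"
  shows "mat_le d A (complex_of_real c \<cdot>\<^sub>m B) \<longleftrightarrow> (\<forall>x. qf d A x \<le> c * qf d B x)"
proof -
  have c: "A \<in> carrier_mat d d" "B \<in> carrier_mat d d" using assms by (auto simp: hermitian_mat_def)
  have "complex_of_real c \<cdot>\<^sub>m B \<in> carrier_mat d d" using c by simp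
  then show ?thesis
    using hermitian_diff[OF hermitian_smult[OF assms(2)] assms(1), of c] c
    by (simp add: mat_le_def psd_mat_iff qf_diff qf_smult)
qed

lemma spec_carrier: "spec d A u lam \<Longrightarrow> A \<in> carrier_mat d d"
  and spec_onb: "spec d A u lam \<Longrightarrow> onb d u"
  and spec_index: "spec d A u lam \<Longrightarrow> a < d \<Longrightarrow> b < d \<Longrightarrow>
    A $$ (a,b) = (\<Sum>i<d. of_real (lam i) * u i a * cnj (u i b))"
  by (auto simp: spec_def)

lemma spec_hermitian:
  assumes "spec d A u lam"
  shows "hermitian_mat d A"
  unfolding hermitian_mat_iff using spec_carrier[OF assms] spec_index[OF assms]
  by (auto simp: mult_ac)

lemma hermitian_spec:
  assumes "hermitian_mat d A"
  shows "\<exists>u lam. spec d A u lam"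
proof -
  have A: "A \<in> carrier_mat d d" and h: "\<And>a b. a < d \<Longrightarrow> b < d \<Longrightarrow> A $$ (b,a) = cnj (A $$ (a,b))"
    using assms unfolding hermitian_mat_iff by blast+
  obtain u and lam :: "nat \<Rightarrow> real" where u: "onb d u"
    and ev: "\<forall>i<d. \<forall>a<d. mv d (\<lambda>a b. A $$ (a,b)) (u i) a = of_real (lam i) * u i a"
    using hermitian_eigenbasis[of d "\<lambda>a b. A $$ (a,b)", OF h] by blast
  have "A $$ (a,b) = (\<Sum>i<d. of_real (lam i) * u i a * cnj (u i b))" if "a < d" "b < d" for a b
  proof -
    have "(\<Sum>i<d. of_real (lam i) * u i a * cnj (u i b))
        = (\<Sum>i<d. mv d (\<lambda>a b. A $$ (a,b)) (u i) a * cnj (u i b))"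
      using ev that by (intro sum.cong refl) auto
    also have "\<dots> = (\<Sum>c<d. A $$ (a,c) * (\<Sum>i<d. u i c * cnj (u i b)))"
      unfolding mv_def sum_distrib_left sum_distrib_right by (subst sum.swap) (simp add: mult_ac)
    also have "\<dots> = (\<Sum>c<d. A $$ (a,c) * of_bool (b = c))"
      using that by (intro sum.cong refl) (auto simp: onb_complete[OF u])
    also have "\<dots> = A $$ (a,b)" using that by (intro sum_of_bool_mult)
    finally show ?thesis by simp
  qed
  then show ?thesis using A u by (auto simp: spec_def)
qed

lemma cip_mult_cnj: "cip d x y * cip d y x = of_real ((cmod (cip d y x))\<^sup>2)"
  by (metis cip_cnj complex_norm_square mult.commute)

text \<open>Stated for arbitrary vectors so that it also covers the truncated state in
  \<open>typical_truncation\<close>, built from projected eigenvectors that are in general not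
  orthogonal.\<close>

lemma qf_rank_one_sum:
  assumes "\<And>a b. a < d \<Longrightarrow> b < d \<Longrightarrow> A $$ (a,b) = (\<Sum>i\<in>I. of_real (lam i) * u i a * cnj (u i b))"
  shows "qf d A x = (\<Sum>i\<in>I. lam i * (cmod (cip d (u i) x))\<^sup>2)"
proof -
  have "(\<Sum>a<d. \<Sum>b<d. cnj (x a) * A $$ (a,b) * x b)
      = (\<Sum>a<d. \<Sum>b<d. \<Sum>i\<in>I. of_real (lam i) * (cnj (x a) * u i a) * (cnj (u i b) * x b))"
    using assms by (intro sum.cong refl) (simp add: sum_distrib_left sum_distrib_right mult_ac)
  also have "\<dots> = (\<Sum>i\<in>I. \<Sum>a<d. \<Sum>b<d. of_real (lam i) * (cnj (x a) * u i a) * (cnj (u i b) * x b))"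
    by (simp add: sum.swap[of _ _ I])
  also have "\<dots> = (\<Sum>i\<in>I. of_real (lam i) * (cip d x (u i) * cip d (u i) x))"
    by (simp add: cip_def sum_distrib_left sum_distrib_right mult_ac)
  also have "\<dots> = of_real (\<Sum>i\<in>I. lam i * (cmod (cip d (u i) x))\<^sup>2)"
    by (simp only: cip_mult_cnj of_real_sum of_real_mult)
  finally show ?thesis by (simp add: qf_def)
qed

lemma qf_spec:
  assumes "spec d A u lam"
  shows "qf d A x = (\<Sum>i<d. lam i * (cmod (cip d (u i) x))\<^sup>2)"
  by (rule qf_rank_one_sum) (rule spec_index[OF assms])

lemma sum_of_bool_mult_real: "i < (k::nat) \<Longrightarrow> (\<Sum>j<k. f j * of_bool (j = i)) = (f i :: real)"
  by (subst sum.remove[of _ i]) auto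

lemma qf_eigenvector:
  assumes "spec d A u lam" "i < d"
  shows "qf d A (u i) = lam i"
proof -
  have "qf d A (u i) = (\<Sum>j<d. lam j * of_bool (j = i))"
    unfolding qf_spec[OF assms(1)] using onbD[OF spec_onb[OF assms(1)]] assms(2)
    by (intro sum.cong refl) auto
  then show ?thesis using sum_of_bool_mult_real[OF assms(2)] by simp
qed

lemma psd_spec_nonneg: "psd_mat d A \<Longrightarrow> spec d A u lam \<Longrightarrow> i < d \<Longrightarrow> lam i \<ge> 0"
  using qf_eigenvector[of d A u lam i] by (simp add: psd_mat_iff flip: qf_eigenvector)

lemma spec_psd: "spec d A u lam \<Longrightarrow> (\<And>i. i < d \<Longrightarrow> lam i \<ge> 0) \<Longrightarrow> psd_mat d A"
  unfolding psd_mat_iff by (auto simp: spec_hermitian qf_spec intro!: sum_nonneg)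

lemma psd_hermitian: "psd_mat d A \<Longrightarrow> hermitian_mat d A"
  by (simp add: psd_mat_def)

text \<open>Summing over \<open>j\<close> first produces the completeness relation of
  \<open>v\<close>. For a state, the summands are the outcome probabilities of a measurement in the
  basis \<open>v\<close>.\<close>

lemma mtrace_onb:
  assumes A: "A \<in> carrier_mat d d" and v: "onb d v"
  shows "(\<Sum>j<d. qf d A (v j)) = Re (mtrace A)"
proof -
  have "(\<Sum>j<d. qf d A (v j)) = Re (\<Sum>a<d. \<Sum>b<d. \<Sum>j<d. cnj (v j a) * A $$ (a,b) * v j b)"
    unfolding qf_def Re_sum[symmetric]
    by (subst sum.swap, subst (2) sum.swap) (rule refl)
  also have "(\<Sum>a<d. \<Sum>b<d. \<Sum>j<d. cnj (v j a) * A $$ (a,b) * v j b)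
      = (\<Sum>a<d. \<Sum>b<d. A $$ (a,b) * (\<Sum>j<d. v j b * cnj (v j a)))"
    by (simp add: sum_distrib_left mult_ac)
  also have "\<dots> = (\<Sum>a<d. \<Sum>b<d. A $$ (a,b) * of_bool (a = b))"
    by (intro sum.cong refl) (auto simp: onb_complete[OF v])
  also have "\<dots> = (\<Sum>a<d. A $$ (a,a))"
    by (intro sum.cong refl sum_of_bool_mult) auto
  finally show ?thesis using A by (simp add: mtrace_def)
qed

lemma spec_mtrace:
  assumes "spec d A u lam"
  shows "Re (mtrace A) = (\<Sum>i<d. lam i)"
  using mtrace_onb[OF spec_carrier spec_onb, OF assms assms] qf_eigenvector[OF assms] by simp

lemma mtrace_mult_spec:
  assumes A: "A \<in> carrier_mat d d" and H: "spec d H v h"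
  shows "Re (mtrace (A * H)) = (\<Sum>j<d. h j * qf d A (v j))"
proof -
  have "mtrace (A * H) = (\<Sum>a<d. \<Sum>b<d. A $$ (a,b) * H $$ (b,a))"
    using A spec_carrier[OF H] by (simp add: mtrace_def scalar_prod_def atLeast0LessThan)
  also have "\<dots> = (\<Sum>a<d. \<Sum>b<d. \<Sum>j<d. of_real (h j) * (cnj (v j a) * A $$ (a,b) * v j b))"
    using spec_index[OF H] by (intro sum.cong refl) (simp add: sum_distrib_left mult_ac)
  also have "\<dots> = (\<Sum>j<d. of_real (h j) * (\<Sum>a<d. \<Sum>b<d. cnj (v j a) * A $$ (a,b) * v j b))"
    unfolding sum_distrib_left
    by (subst (3) sum.swap, subst (2) sum.swap) (rule refl)
  finally show ?thesis by (simp add: qf_def)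
qed

lemma spec_eigenvector:
  assumes A: "spec d A u lam" and "i < d" "a < d"
  shows "(\<Sum>b<d. A $$ (a,b) * u i b) = of_real (lam i) * u i a"
proof -
  have "(\<Sum>b<d. A $$ (a,b) * u i b) = (\<Sum>b<d. \<Sum>j<d. of_real (lam j) * u j a * (cnj (u j b) * u i b))"
    using assms spec_index[OF A]
    by (intro sum.cong refl) (simp add: sum_distrib_left sum_distrib_right mult_ac)
  also have "\<dots> = (\<Sum>j<d. of_real (lam j) * u j a * cip d (u j) (u i))"
    by (subst sum.swap) (simp add: cip_def sum_distrib_left mult_ac)
  also have "\<dots> = (\<Sum>j<d. of_real (lam j) * u j a * of_bool (i = j))"
    using onbD[OF spec_onb[OF A]] assms by (intro sum.cong refl) auto
  finally show ?thesis using sum_of_bool_mult[OF assms(2)] by simp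
qed

text \<open>Both sides are <v_j, A u_i>, with \<open>A\<close> acting to the right or to the left.
  Hence an overlap can be nonzero only between eigenvectors with equal eigenvalues.\<close>

lemma cip_spec_swap:
  assumes A: "spec d A u lam" and B: "spec d A v mu" and "i < d" "j < d"
  shows "of_real (lam i) * cip d (v j) (u i) = of_real (mu j) * cip d (v j) (u i)"
proof -
  let ?A = "\<lambda>a b. A $$ (a,b)"
  have h: "cip d (v j) (mv d ?A (u i)) = cip d (mv d ?A (v j)) (u i)"
    using spec_hermitian[OF A] unfolding hermitian_mat_iff by (intro cip_mv_hermitian) blast
  have "cip d (v j) (mv d ?A (u i)) = cip d (v j) (\<lambda>a. of_real (lam i) * u i a)"
    unfolding mv_def by (intro cip_cong refl spec_eigenvector[OF A]) (use assms in auto)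
  moreover have "cip d (mv d ?A (v j)) (u i) = cip d (\<lambda>a. of_real (mu j) * v j a) (u i)"
    unfolding mv_def by (intro cip_cong refl spec_eigenvector[OF B]) (use assms in auto)
  ultimately show ?thesis using h by (auto simp: cip_scale_left cip_scale_right)
qed

text \<open>Expand \<open>u i\<close> in the basis \<open>v\<close>: only overlaps with
  \<open>lam i = mu j\<close> survive, and there \<open>f (lam i)\<close> may be exchanged for
  \<open>f (mu j)\<close>.\<close>

lemma functional_calculus_unique:
  assumes A: "spec d A u lam" and B: "spec d A v mu" and ab: "a < d" "b < d"
  shows "(\<Sum>i<d. of_real (f (lam i)) * u i a * cnj (u i b))
       = (\<Sum>j<d. of_real (f (mu j)) * v j a * cnj (v j b))"
proof -
  have swap: "of_real (f (lam i)) * cip d (v j) (u i) = of_real (f (mu j)) * cip d (v j) (u i)"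
    if "i < d" "j < d" for i j
    using cip_spec_swap[OF A B that] by (cases "lam i = mu j") auto
  have "(\<Sum>i<d. of_real (f (lam i)) * u i a * cnj (u i b))
      = (\<Sum>i<d. \<Sum>j<d. of_real (f (lam i)) * cip d (v j) (u i) * v j a * cnj (u i b))"
  proof (intro sum.cong refl)
    fix i
    have "u i a = (\<Sum>j<d. cip d (v j) (u i) * v j a)" by (rule onb_expand[OF spec_onb[OF B] ab(1)])
    then show "of_real (f (lam i)) * u i a * cnj (u i b)
      = (\<Sum>j<d. of_real (f (lam i)) * cip d (v j) (u i) * v j a * cnj (u i b))"
      by (simp add: sum_distrib_left sum_distrib_right mult_ac)
  qed
  also have "\<dots> = (\<Sum>i<d. \<Sum>j<d. of_real (f (mu j)) * cip d (v j) (u i) * v j a * cnj (u i b))"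
    using swap by (intro sum.cong refl) auto
  also have "\<dots> = (\<Sum>j<d. of_real (f (mu j)) * v j a * cnj (\<Sum>i<d. cip d (u i) (v j) * u i b))"
    by (subst sum.swap) (simp add: sum_distrib_left cip_cnj mult_ac)
  also have "\<dots> = (\<Sum>j<d. of_real (f (mu j)) * v j a * cnj (v j b))"
    by (simp flip: onb_expand[OF spec_onb[OF A] ab(2)])
  finally show ?thesis .
qed

lemma unitary_diag_index:
  assumes "U \<in> carrier_mat d d" "a < d" "b < d"
  shows "(U * mat_diag d (\<lambda>i. complex_of_real (lam i)) * mat_adjoint U) $$ (a,b)
    = (\<Sum>i<d. of_real (lam i) * U $$ (a,i) * cnj (U $$ (b,i)))"
proof -
  note c = mat_adjoint_carrier[OF assms(1)]
  show ?thesis unfolding mat_diag_mult_right[OF assms(1)]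
    using assms c
    by (simp add: scalar_prod_def atLeast0LessThan mat_adjoint_index[OF assms(1)] mult_ac)
qed

lemma unitary_onb:
  assumes "unitary_mat d U"
  shows "onb d (\<lambda>i a. U $$ (a,i))"
proof -
  have U: "U \<in> carrier_mat d d" and UU: "mat_adjoint U * U = 1\<^sub>m d"
    using assms by (auto simp: unitary_mat_def)
  note c = mat_adjoint_carrier[OF U]
  have "cip d (\<lambda>a. U $$ (a,i)) (\<lambda>a. U $$ (a,j)) = of_bool (i = j)" if "i < d" "j < d" for i j
  proof -
    have "(mat_adjoint U * U) $$ (i,j) = cip d (\<lambda>a. U $$ (a,i)) (\<lambda>a. U $$ (a,j))"
      using that U c by (simp add: scalar_prod_def cip_def atLeast0LessThan mat_adjoint_index[OF U])
    then show ?thesis using that by (simp add: UU split: if_splits)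
  qed
  then show ?thesis by (intro orthon_imp_onb) (simp add: orthon_def)
qed

lemma onb_unitary:
  assumes u: "onb d u"
  shows "unitary_mat d (Matrix.mat d d (\<lambda>(a,i). u i a))"
proof -
  let ?U = "Matrix.mat d d (\<lambda>(a,i). u i a)"
  have U: "?U \<in> carrier_mat d d" by simp
  note c = mat_adjoint_carrier[OF U]
  have "mat_adjoint ?U * ?U = 1\<^sub>m d"
  proof (rule eq_matI)
    fix i j assume ij: "i < dim_row (1\<^sub>m d :: complex mat)" "j < dim_col (1\<^sub>m d :: complex mat)"
    then have "(mat_adjoint ?U * ?U) $$ (i,j) = cip d (u i) (u j)"
      using c by (simp add: scalar_prod_def cip_def atLeast0LessThan mat_adjoint_index[OF U])
    then show "(mat_adjoint ?U * ?U) $$ (i,j) = 1\<^sub>m d $$ (i,j)" using ij onbD[OF u, of i j] by simp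
  qed (use c in auto)
  then show ?thesis using mat_mult_left_right_inverse[OF c U] by (simp add: unitary_mat_def)
qed

text \<open>The given decomposition witnesses that the choice in \<open>spectral_decomp\<close>
  succeeds; \<open>functional_calculus_unique\<close> then carries the result from the chosen basis
  back to \<open>u\<close>.\<close>

lemma mat_fun_spec:
  assumes A: "spec d A u lam"
  shows "spec d (mat_fun d f A) u (\<lambda>i. f (lam i))"
proof -
  let ?P = "\<lambda>(U, lam). unitary_mat d U \<and> A = U * mat_diag d (\<lambda>i. complex_of_real (lam i)) * mat_adjoint U"
  let ?U = "Matrix.mat d d (\<lambda>(a,i). u i a)"
  have U: "?U \<in> carrier_mat d d" by simp
  have "?P (?U, lam)"
  proof -
    have "A = ?U * mat_diag d (\<lambda>i. complex_of_real (lam i)) * mat_adjoint ?U"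
    proof (rule eq_matI)
      fix a b assume "a < dim_row (?U * mat_diag d (\<lambda>i. complex_of_real (lam i)) * mat_adjoint ?U)"
        "b < dim_col (?U * mat_diag d (\<lambda>i. complex_of_real (lam i)) * mat_adjoint ?U)"
      then have ab: "a < d" "b < d" using mat_adjoint_carrier[OF U] by auto
      show "A $$ (a,b) = (?U * mat_diag d (\<lambda>i. complex_of_real (lam i)) * mat_adjoint ?U) $$ (a,b)"
        unfolding unitary_diag_index[OF U ab] using spec_index[OF A ab] ab by simp
    qed (use spec_carrier[OF A] mat_adjoint_carrier[OF U] in auto)
    then show ?thesis using onb_unitary[OF spec_onb[OF A]] by simp
  qed
  then have "?P (spectral_decomp d A)" unfolding spectral_decomp_def by (rule someI)
  then obtain V mu where V: "spectral_decomp d A = (V, mu)" "unitary_mat d V"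
    "A = V * mat_diag d (\<lambda>i. complex_of_real (mu i)) * mat_adjoint V"
    by (cases "spectral_decomp d A") auto
  have Vc: "V \<in> carrier_mat d d" using V(2) by (auto simp: unitary_mat_def)
  have B: "spec d A (\<lambda>i a. V $$ (a,i)) mu"
    unfolding spec_def
  proof (intro conjI allI impI)
    fix a b assume "a < d" "b < d"
    from unitary_diag_index[OF Vc this, of mu]
    show "A $$ (a,b) = (\<Sum>i<d. of_real (mu i) * V $$ (a,i) * cnj (V $$ (b,i)))"
      unfolding V(3)[symmetric] .
  qed (rule spec_carrier[OF A] unitary_onb[OF V(2)])+
  have "mat_fun d f A = V * mat_diag d (\<lambda>i. complex_of_real (f (mu i))) * mat_adjoint V"
    by (simp add: mat_fun_def V(1))
  moreover have "V * mat_diag d (\<lambda>i. complex_of_real (f (mu i))) * mat_adjoint V \<in> carrier_mat d d"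
    using mult_carrier_mat[OF mult_carrier_mat[OF Vc mat_diag_dim] mat_adjoint_carrier[OF Vc]] .
  ultimately show ?thesis
    unfolding spec_def using spec_onb[OF A]
    by (auto simp: functional_calculus_unique[OF A B] intro: unitary_diag_index[OF Vc])
qed

lemma spec_square:
  assumes A: "spec d A u lam"
  shows "spec d (mat_adjoint A * A) u (\<lambda>i. (lam i)\<^sup>2)"
proof -
  have c: "A \<in> carrier_mat d d" by (rule spec_carrier[OF A])
  have adj: "mat_adjoint A = A" using spec_hermitian[OF A] by (simp add: hermitian_mat_def)
  have "(A * A) $$ (a,b) = (\<Sum>i<d. of_real ((lam i)\<^sup>2) * u i a * cnj (u i b))" if "a < d" "b < d" for a b
  proof -
    have "(A * A) $$ (a,b) = (\<Sum>e<d. A $$ (a,e) * A $$ (e,b))"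
      using that c by (simp add: scalar_prod_def atLeast0LessThan)
    also have "\<dots> = (\<Sum>e<d. \<Sum>i<d. A $$ (a,e) * u i e * (of_real (lam i) * cnj (u i b)))"
      using spec_index[OF A _ that(2)] by (intro sum.cong refl) (simp add: sum_distrib_left mult_ac)
    also have "\<dots> = (\<Sum>i<d. (\<Sum>e<d. A $$ (a,e) * u i e) * (of_real (lam i) * cnj (u i b)))"
      by (subst sum.swap) (simp add: sum_distrib_right)
    also have "\<dots> = (\<Sum>i<d. of_real ((lam i)\<^sup>2) * u i a * cnj (u i b))"
      using that by (intro sum.cong refl) (simp add: spec_eigenvector[OF A] power2_eq_square)
    finally show ?thesis .
  qed
  then show ?thesis unfolding adj using c spec_onb[OF A] by (simp add: spec_def)
qed

lemma trace_norm_spec: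
  assumes "spec d A u lam"
  shows "trace_norm d A = (\<Sum>i<d. \<bar>lam i\<bar>)"
  unfolding trace_norm_def using spec_mtrace[OF mat_fun_spec[OF spec_square[OF assms], of sqrt]] by simp

text \<open>Pinching contracts the trace norm: each diagonal entry is an average of eigenvalues with
  weights |<u_i, v_j>|^2, and for fixed \<open>i\<close> these weights also sum to 1 over
  \<open>j\<close>.\<close>

lemma sum_abs_qf_le_trace_norm:
  assumes "hermitian_mat d X" and v: "onb d v"
  shows "(\<Sum>j<d. \<bar>qf d X (v j)\<bar>) \<le> trace_norm d X"
proof -
  obtain u x where X: "spec d X u x" using hermitian_spec[OF assms(1)] by blast
  have "(\<Sum>j<d. \<bar>qf d X (v j)\<bar>) \<le> (\<Sum>j<d. \<Sum>i<d. \<bar>x i\<bar> * (cmod (cip d (u i) (v j)))\<^sup>2)"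
    unfolding qf_spec[OF X] by (intro sum_mono order_trans[OF sum_abs]) (simp add: abs_mult)
  also have "\<dots> = (\<Sum>i<d. \<bar>x i\<bar> * (\<Sum>j<d. (cmod (cip d (v j) (u i)))\<^sup>2))"
    unfolding sum_distrib_left
    by (subst sum.swap) (intro sum.cong refl, metis cip_cnj complex_mod_cnj)
  also have "\<dots> = (\<Sum>i<d. \<bar>x i\<bar>)"
    using nrm2_onb[OF spec_onb[OF X]] by (simp add: onb_parseval[OF v])
  finally show ?thesis by (simp add: trace_norm_spec[OF X])
qed

text \<open>The second sum is Tr w log s, the expectation of the log-eigenvalues of \<open>s\<close>
  under the diagonal of \<open>w\<close> in the eigenbasis of \<open>s\<close>. In this form scalar
  inequalities apply term by term.\<close>

lemma rel_entropy_spec: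
  assumes w: "spec d w u lam" and s: "spec d s v mu"
  shows "Re (mtrace (w * (mat_fun d log2_supp w - mat_fun d log2_supp s)))
    = (\<Sum>i<d. lam i * log2_supp (lam i)) - (\<Sum>j<d. log2_supp (mu j) * qf d w (v j))"
proof -
  note W = mat_fun_spec[OF w, of log2_supp] and S = mat_fun_spec[OF s, of log2_supp]
  note c = spec_carrier[OF w] spec_carrier[OF W] spec_carrier[OF S]
  have "mtrace (w * (mat_fun d log2_supp w - mat_fun d log2_supp s))
      = mtrace (w * mat_fun d log2_supp w) - mtrace (w * mat_fun d log2_supp s)"
    unfolding mult_minus_distrib_mat[OF c] using c by (simp add: mtrace_def sum_subtractf)
  then show ?thesis
    using mtrace_mult_spec[OF c(1) W] mtrace_mult_spec[OF c(1) S] qf_eigenvector[OF w]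
    by (simp add: mult.commute)
qed

section \<open>Relative entropy versus max-relative entropy\<close>

text \<open>The equal mixture of \<open>A\<close> with the maximally mixed state. For positive
  \<open>A\<close> its eigenvalues are at least 1/(2 d), and \<open>A\<close> is at most twice the
  mixture, a price of one bit.\<close>

definition depol :: "nat \<Rightarrow> complex mat \<Rightarrow> complex mat" where
  "depol d A = Matrix.mat d d (\<lambda>(a,b). (A $$ (a,b) + of_bool (a = b) / of_nat d) / 2)"

lemma depol_spec:
  assumes A: "spec d A u lam"
  shows "spec d (depol d A) u (\<lambda>i. (lam i + 1 / real d) / 2)"
proof -
  have "(\<Sum>i<d. complex_of_real ((lam i + 1 / real d) / 2) * u i a * cnj (u i b))
      = ((\<Sum>i<d. of_real (lam i) * u i a * cnj (u i b)) + (\<Sum>i<d. u i a * cnj (u i b)) / of_nat d) / 2"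
    for a b
  proof -
    have "(\<Sum>i<d. complex_of_real ((lam i + 1 / real d) / 2) * u i a * cnj (u i b))
      = (\<Sum>i<d. of_real (lam i) * u i a * cnj (u i b) / 2 + u i a * cnj (u i b) / of_nat d / 2)"
      by (intro sum.cong refl) (simp add: distrib_right add_divide_distrib)
    then show ?thesis by (simp add: sum.distrib sum_divide_distrib add_divide_distrib)
  qed
  then show ?thesis
    using spec_onb[OF A] spec_index[OF A] by (simp add: spec_def depol_def onb_complete)
qed

lemma doubly_stochastic:
  assumes u: "onb d u" and v: "onb d v"
  shows "i < d \<Longrightarrow> (\<Sum>j<d. (cmod (cip d (u i) (v j)))\<^sup>2) = 1"
    and "j < d \<Longrightarrow> (\<Sum>i<d. (cmod (cip d (u i) (v j)))\<^sup>2) = 1"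
proof -
  have sym: "cmod (cip d x y) = cmod (cip d y x)" for x y by (metis cip_cnj complex_mod_cnj)
  show "i < d \<Longrightarrow> (\<Sum>j<d. (cmod (cip d (u i) (v j)))\<^sup>2) = 1"
    unfolding sym[of "u i"] onb_parseval[OF v] by (rule nrm2_onb[OF u])
  show "j < d \<Longrightarrow> (\<Sum>i<d. (cmod (cip d (u i) (v j)))\<^sup>2) = 1"
    unfolding onb_parseval[OF u] by (rule nrm2_onb[OF v])
qed

text \<open>The sum is t = <u_i, S^-1 u_i>. On the test vector the left side of \<open>le\<close> is
  at least \<open>w i\<close> times t^2 and the right side is l t; cancel t.\<close>

lemma inverse_expectation_bound:
  assumes W: "spec d W u w" and S: "spec d S v s"
    and wpos: "\<And>i. i < d \<Longrightarrow> w i \<ge> 0" and spos: "\<And>j. j < d \<Longrightarrow> s j > 0"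
    and le: "\<And>x. qf d W x \<le> l * qf d S x" and l: "l > 0" and i: "i < d"
  shows "w i * (\<Sum>j<d. (cmod (cip d (u i) (v j)))\<^sup>2 / s j) \<le> l"
proof -
  let ?t = "\<Sum>j<d. (cmod (cip d (u i) (v j)))\<^sup>2 / s j"
  note u = spec_onb[OF W] and v = spec_onb[OF S]
  \<comment> \<open>Test the operator inequality on the vector \<open>S\<^sup>-\<^sup>1 u\<^sub>i\<close>.\<close>
  define x where "x a = (\<Sum>j<d. (cip d (v j) (u i) / of_real (s j)) * v j a)" for a
  have vx: "cip d (v j) x = cip d (v j) (u i) / of_real (s j)" if "j < d" for j
  proof -
    have "cip d (v j) x = (\<Sum>k<d. (cip d (v k) (u i) / of_real (s k)) * cip d (v j) (v k))"
      unfolding x_def cip_sum_right ..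
    also have "\<dots> = (\<Sum>k<d. (cip d (v k) (u i) / of_real (s k)) * of_bool (j = k))"
      using that by (intro sum.cong refl) (simp add: onbD[OF v])
    also have "\<dots> = cip d (v j) (u i) / of_real (s j)" using that by (rule sum_of_bool_mult)
    finally show ?thesis .
  qed
  have "cip d (u i) x = (\<Sum>j<d. (cip d (v j) (u i) / of_real (s j)) * cip d (u i) (v j))"
    unfolding x_def cip_sum_right ..
  also have "\<dots> = (\<Sum>j<d. of_real ((cmod (cip d (u i) (v j)))\<^sup>2 / s j))"
    using cip_mult_cnj[of d "v _" "u i"] by (intro sum.cong refl) (simp add: field_simps)
  finally have ux: "cip d (u i) x = of_real ?t" by simp
  have "qf d S x = ?t"
    unfolding qf_spec[OF S]
  proof (intro sum.cong refl)
    fix j assume "j \<in> {..<d}"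
    then have j: "j < d" by simp
    have "cmod (cip d (v j) (u i)) = cmod (cip d (u i) (v j))" by (metis cip_cnj complex_mod_cnj)
    then show "s j * (cmod (cip d (v j) x))\<^sup>2 = (cmod (cip d (u i) (v j)))\<^sup>2 / s j"
      using spos[OF j] by (simp add: vx[OF j] norm_divide power_divide field_simps power2_eq_square)
  qed
  moreover have "w i * ?t\<^sup>2 \<le> qf d W x"
  proof -
    have "w i * (cmod (cip d (u i) x))\<^sup>2 \<le> qf d W x"
      unfolding qf_spec[OF W] using i wpos by (intro member_le_sum) auto
    then show ?thesis unfolding ux norm_of_real power2_abs .
  qed
  moreover have "?t \<ge> 0" using spos by (intro sum_nonneg) (simp add: less_imp_le)
  ultimately have *: "w i * ?t * ?t \<le> l * ?t" and t: "?t \<ge> 0"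
    using le[of x] by (auto simp: power2_eq_square mult.assoc)
  show ?thesis
  proof (cases "?t = 0")
    case False
    then show ?thesis using * t by (simp add: mult_le_cancel_right)
  qed (use l in simp)
qed

text \<open>For each \<open>i\<close> the logarithm is replaced by its tangent at
  \<open>w i = l * s j\<close>; by \<open>inverse_expectation_bound\<close> the linear correction
  has a nonpositive average in the overlap weights. The trace of \<open>W\<close> is a factor
  because smoothing produces subnormalized operators.\<close>

lemma rel_entropy_le_log:
  assumes W: "spec d W u w" and S: "spec d S v s"
    and wpos: "\<And>i. i < d \<Longrightarrow> w i \<ge> 0" and spos: "\<And>j. j < d \<Longrightarrow> s j > 0"
    and le: "\<And>x. qf d W x \<le> l * qf d S x" and l: "l > 0"
  shows "(\<Sum>i<d. w i * log2_supp (w i)) - (\<Sum>j<d. log2_supp (s j) * qf d W (v j)) \<le> log 2 l * (\<Sum>i<d. w i)"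
proof -
  define c where "c i j = (cmod (cip d (u i) (v j)))\<^sup>2" for i j
  have c1: "(\<Sum>j<d. c i j) = 1" if "i < d" for i
    unfolding c_def using doubly_stochastic(1)[OF spec_onb[OF W] spec_onb[OF S] that] .
  have "w i * log2_supp (w i) - (\<Sum>j<d. log2_supp (s j) * (w i * c i j)) \<le> log 2 l * w i"
    if i: "i < d" for i
  proof (cases "w i = 0")
    case False
    then have w: "w i > 0" using wpos[OF i] by simp
    have t: "w i * (\<Sum>j<d. c i j / s j) \<le> l"
      unfolding c_def by (rule inverse_expectation_bound[OF W S wpos spos le l i])
    have ineq: "log 2 (w i) - log 2 (s j) \<le> log 2 l + (w i / (l * s j) - 1) / ln 2" if "j < d" for j
    proof -
      have "ln (w i / (l * s j)) \<le> w i / (l * s j) - 1"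
        using w l spos[OF that] by (intro ln_le_minus_one) simp
      then have "ln (w i) - ln (s j) \<le> ln l + (w i / (l * s j) - 1)"
        using w l spos[OF that] by (simp add: ln_div ln_mult)
      then have "(ln (w i) - ln (s j)) / ln 2 \<le> (ln l + (w i / (l * s j) - 1)) / ln 2"
        by (intro divide_right_mono) auto
      then show ?thesis by (simp add: log_def add_divide_distrib diff_divide_distrib)
    qed
    have "w i * log2_supp (w i) - (\<Sum>j<d. log2_supp (s j) * (w i * c i j))
        = w i * log 2 (w i) * (\<Sum>j<d. c i j) - (\<Sum>j<d. log 2 (s j) * (w i * c i j))"
      using c1[OF i] w spos by (simp add: log2_supp_def)
    also have "\<dots> = (\<Sum>j<d. w i * c i j * (log 2 (w i) - log 2 (s j)))"
      by (simp add: sum_distrib_left sum_distrib_right sum_subtractf algebra_simps)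
    also have "\<dots> \<le> (\<Sum>j<d. w i * c i j * (log 2 l + (w i / (l * s j) - 1) / ln 2))"
      using w ineq by (intro sum_mono mult_left_mono) (auto simp: c_def)
    also have "\<dots> = (\<Sum>j<d. (w i * (log 2 l - 1 / ln 2)) * c i j + (w i * w i / (l * ln 2)) * (c i j / s j))"
      using l by (intro sum.cong refl) (simp add: field_simps)
    also have "\<dots> = w i * (log 2 l - 1 / ln 2) + w i * (w i * (\<Sum>j<d. c i j / s j)) / (l * ln 2)"
      unfolding sum.distrib sum_distrib_left[symmetric] c1[OF i] by simp
    also have "\<dots> \<le> w i * (log 2 l - 1 / ln 2) + w i * l / (l * ln 2)"
      using t w l by (intro add_left_mono divide_right_mono mult_left_mono) auto
    also have "\<dots> = log 2 l * w i" using l by (simp add: field_simps)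
    finally show ?thesis .
  qed simp
  then have "(\<Sum>i<d. w i * log2_supp (w i) - (\<Sum>j<d. log2_supp (s j) * (w i * c i j))) \<le> (\<Sum>i<d. log 2 l * w i)"
    by (intro sum_mono) auto
  moreover have "(\<Sum>j<d. log2_supp (s j) * qf d W (v j)) = (\<Sum>i<d. \<Sum>j<d. log2_supp (s j) * (w i * c i j))"
    unfolding qf_spec[OF W] c_def sum_distrib_left by (rule sum.swap)
  ultimately show ?thesis by (simp add: sum_subtractf sum_distrib_left)
qed

text \<open>Again the tangent estimate, now bounding from below, averaged with overlap weights that
  sum to 1 in both indices. The difference of traces remains because \<open>W\<close> may be
  subnormalized.\<close>

lemma klein_inequality:
  assumes W: "spec d W u w" and T: "spec d T v t"
    and wpos: "\<And>i. i < d \<Longrightarrow> w i \<ge> 0" and tpos: "\<And>j. j < d \<Longrightarrow> t j > 0"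
  shows "(\<Sum>i<d. w i * log2_supp (w i)) - (\<Sum>j<d. log2_supp (t j) * qf d W (v j))
    \<ge> ((\<Sum>i<d. w i) - (\<Sum>j<d. t j)) / ln 2"
proof -
  define c where "c i j = (cmod (cip d (u i) (v j)))\<^sup>2" for i j
  have c1: "(\<Sum>j<d. c i j) = 1" if "i < d" for i
    unfolding c_def using doubly_stochastic(1)[OF spec_onb[OF W] spec_onb[OF T] that] .
  have c2: "(\<Sum>i<d. c i j) = 1" if "j < d" for j
    unfolding c_def using doubly_stochastic(2)[OF spec_onb[OF W] spec_onb[OF T] that] .
  have ineq: "(w i - t j) / ln 2 \<le> w i * log2_supp (w i) - log2_supp (t j) * w i"
    if "i < d" "j < d" for i j
  proof (cases "w i = 0")
    case False
    then have w: "w i > 0" using wpos that by (simp add: less_le)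
    have "ln (t j / w i) \<le> t j / w i - 1"
      using w tpos that by (intro ln_le_minus_one) simp
    then have "w i * (ln (t j) - ln (w i)) \<le> w i * (t j / w i - 1)"
      using w tpos[OF that(2)] by (simp add: ln_div)
    then have "w i - t j \<le> w i * (ln (w i) - ln (t j))" using w by (simp add: algebra_simps)
    then have "(w i - t j) / ln 2 \<le> w i * (ln (w i) - ln (t j)) / ln 2"
      by (intro divide_right_mono) auto
    then show ?thesis using w tpos[OF that(2)]
      by (simp add: log2_supp_def log_def algebra_simps diff_divide_distrib)
  qed (use tpos[OF that(2)] in simp)
  have "((\<Sum>i<d. w i) - (\<Sum>j<d. t j)) / ln 2
      = ((\<Sum>i<d. w i * (\<Sum>j<d. c i j)) - (\<Sum>j<d. t j * (\<Sum>i<d. c i j))) / ln 2"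
    using c1 c2 by simp
  also have "(\<Sum>j<d. t j * (\<Sum>i<d. c i j)) = (\<Sum>i<d. \<Sum>j<d. t j * c i j)"
    unfolding sum_distrib_left by (rule sum.swap)
  also have "((\<Sum>i<d. w i * (\<Sum>j<d. c i j)) - (\<Sum>i<d. \<Sum>j<d. t j * c i j)) / ln 2
      = (\<Sum>i<d. \<Sum>j<d. c i j * ((w i - t j) / ln 2))"
    by (simp add: sum_distrib_left sum_subtractf[symmetric] sum_divide_distrib algebra_simps)
  also have "\<dots> \<le> (\<Sum>i<d. \<Sum>j<d. c i j * (w i * log2_supp (w i) - log2_supp (t j) * w i))"
    using ineq by (intro sum_mono mult_left_mono) (auto simp: c_def)
  also have "\<dots> = (\<Sum>i<d. w i * log2_supp (w i) * (\<Sum>j<d. c i j)) - (\<Sum>i<d. \<Sum>j<d. log2_supp (t j) * (w i * c i j))"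
    by (simp add: sum_distrib_left sum_subtractf[symmetric] algebra_simps)
  also have "(\<Sum>i<d. w i * log2_supp (w i) * (\<Sum>j<d. c i j)) = (\<Sum>i<d. w i * log2_supp (w i))"
    using c1 by simp
  also have "(\<Sum>i<d. \<Sum>j<d. log2_supp (t j) * (w i * c i j)) = (\<Sum>j<d. log2_supp (t j) * qf d W (v j))"
    unfolding qf_spec[OF W] c_def sum_distrib_left by (rule sum.swap)
  finally show ?thesis .
qed

text \<open>Pinching \<open>A - B\<close> to the basis \<open>v\<close> does not increase its trace
  norm; what is left is a Hoelder estimate for the weights \<open>h\<close>.\<close>

lemma expectation_trace_norm_bound:
  assumes "hermitian_mat d A" "hermitian_mat d B" "onb d v" "\<And>j. j < d \<Longrightarrow> \<bar>h j\<bar> \<le> M"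
    and "trace_norm d (A - B) \<le> e" "M \<ge> 0"
  shows "\<bar>(\<Sum>j<d. h j * qf d A (v j)) - (\<Sum>j<d. h j * qf d B (v j))\<bar> \<le> M * e"
proof -
  have "(\<Sum>j<d. h j * qf d A (v j)) - (\<Sum>j<d. h j * qf d B (v j)) = (\<Sum>j<d. h j * qf d (A - B) (v j))"
    using assms(1,2) by (simp add: qf_diff hermitian_carrier sum_subtractf algebra_simps)
  also have "\<bar>\<dots>\<bar> \<le> (\<Sum>j<d. M * \<bar>qf d (A - B) (v j)\<bar>)"
    using assms(4) by (intro order_trans[OF sum_abs] sum_mono) (auto simp: abs_mult intro: mult_right_mono)
  also have "\<dots> \<le> M * e"
    unfolding sum_distrib_left[symmetric] using assms
    by (intro mult_left_mono order_trans[OF sum_abs_qf_le_trace_norm[of d "A - B"]] hermitian_diff) auto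
  finally show ?thesis .
qed

lemma spec_pos_supp_le:
  assumes S: "spec d S v s" and spos: "\<And>j. j < d \<Longrightarrow> s j > 0" and A: "A \<in> carrier_mat d d"
  shows "supp_le d A S"
  unfolding supp_le_def
proof (intro ballI impI)
  fix x :: "complex vec" assume x: "x \<in> carrier_vec d" "S *\<^sub>v x = 0\<^sub>v d"
  have "qf d S (\<lambda>a. x $ a) = 0"
    using qf_vec[OF spec_carrier[OF S] x(1)] x by simp
  then have "(\<Sum>j<d. s j * (cmod (cip d (v j) (\<lambda>a. x $ a)))\<^sup>2) = 0" by (simp add: qf_spec[OF S])
  then have "\<forall>j<d. s j * (cmod (cip d (v j) (\<lambda>a. x $ a)))\<^sup>2 = 0"
    using spos by (subst (asm) sum_nonneg_eq_0_iff) (auto simp: less_imp_le)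
  then have "cip d (v j) (\<lambda>a. x $ a) = 0" if "j < d" for j
    using spos[OF that] that by fastforce
  then have "nrm2 d (\<lambda>a. x $ a) = 0" unfolding onb_parseval[OF spec_onb[OF S], symmetric] by simp
  then have "x = 0\<^sub>v d" using x(1) by (auto simp: nrm2_eq_0_iff)
  then show "A *\<^sub>v x = 0\<^sub>v d" using A by auto
qed

lemma state_spec:
  assumes "state_mat d w"
  obtains u lam where "spec d w u lam" "\<And>i. i < d \<Longrightarrow> lam i \<ge> 0" "(\<Sum>i<d. lam i) = 1"
    "\<And>i. i < d \<Longrightarrow> lam i \<le> 1"
proof -
  have p: "psd_mat d w" "mtrace w = 1" using assms by (auto simp: state_mat_def)
  obtain u lam where s: "spec d w u lam" using hermitian_spec[OF psd_hermitian[OF p(1)]] by blast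
  have nn: "\<And>i. i < d \<Longrightarrow> lam i \<ge> 0" using psd_spec_nonneg[OF p(1) s] .
  have one: "(\<Sum>i<d. lam i) = 1" using spec_mtrace[OF s] p(2) by simp
  have "lam i \<le> 1" if "i < d" for i
    unfolding one[symmetric] using that nn by (intro member_le_sum) auto
  with s nn one show ?thesis by (intro that) auto
qed

text \<open>The mixed eigenvalue lies between 1/(2 d) and 1.\<close>

lemma abs_log_depol:
  assumes "d > 0" "x \<ge> 0" "x \<le> 1"
  shows "\<bar>log2_supp ((x + 1 / real d) / 2)\<bar> \<le> log 2 (2 * real d)"
proof -
  let ?y = "(x + 1 / real d) / 2"
  define r where "r = 1 / real d"
  have "0 < r" "r \<le> 1" using assms(1) by (auto simp: r_def)
  then have "(x + r) / 2 > 0" "(x + r) / 2 \<le> 1" "r / 2 \<le> (x + r) / 2" using assms(2,3) by auto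
  then have y: "?y > 0" "?y \<le> 1" "1 / (2 * real d) \<le> ?y" by (simp_all add: r_def mult.commute)
  have "log 2 (1 / (2 * real d)) \<le> log 2 ?y" using y assms by (subst log_le_cancel_iff) auto
  moreover have "log 2 ?y \<le> 0" using y by simp
  moreover have "log 2 (1 / (2 * real d)) = - log 2 (2 * real d)" using assms by (simp add: log_divide)
  ultimately show ?thesis using y by (simp add: log2_supp_def)
qed

text \<open>Entropy is not linear, so the passage from \<open>w\<close> to \<open>wb\<close> goes
  through the mixture with eigenvalues \<open>t\<close>. Up to one bit, Tr w log w is at most Tr w
  log t; linearity replaces \<open>w\<close> by \<open>wb\<close> at cost \<open>M * e\<close>;
  Klein's inequality leads to Tr wb log wb; \<open>rel_entropy_le_log\<close> and a second linear
  replacement finish. The 3 collects one bit from each of the facts 2, 4 and 5.\<close>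

lemma rel_entropy_depol_le:
  assumes d: "d > 0" and w: "state_mat d w" and s: "state_mat d s"
    and wb: "wb \<in> smooth_ball d e w" and le: "mat_le d wb (complex_of_real l \<cdot>\<^sub>m s)" and l: "l > 0"
    and e: "0 \<le> e" "e \<le> 1/2"
  shows "rel_entropy d w (depol d s) \<le> ereal (log 2 l + 2 * e * log 2 (2 * real d) + 3)"
proof -
  define M where "M = log 2 (2 * real d)"
  have M: "M \<ge> 0" using d by (simp add: M_def)
  obtain u lam where W: "spec d w u lam" and lam: "\<And>i. i < d \<Longrightarrow> lam i \<ge> 0" "(\<Sum>i<d. lam i) = 1"
    "\<And>i. i < d \<Longrightarrow> lam i \<le> 1" using state_spec[OF w] by blast
  obtain v mu where S: "spec d s v mu" and mu: "\<And>i. i < d \<Longrightarrow> mu i \<ge> 0" "(\<Sum>i<d. mu i) = 1"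
    "\<And>i. i < d \<Longrightarrow> mu i \<le> 1" using state_spec[OF s] by blast
  have psd: "psd_mat d wb" and dist: "trace_norm d (wb - w) \<le> e" and tr: "Re (mtrace wb) \<le> Re (mtrace w)"
    using wb by (auto simp: smooth_ball_def)
  note hwb = psd_hermitian[OF psd] and hw = spec_hermitian[OF W] and hs = spec_hermitian[OF S]
  obtain ub om where WB: "spec d wb ub om" using hermitian_spec[OF hwb] by blast
  have om: "\<And>i. i < d \<Longrightarrow> om i \<ge> 0" using psd_spec_nonneg[OF psd WB] .
  define t where "t i = (lam i + 1 / real d) / 2" for i
  define s' where "s' i = (mu i + 1 / real d) / 2" for i
  have T: "spec d (depol d w) u t" unfolding t_def by (rule depol_spec[OF W])
  have S': "spec d (depol d s) v s'" unfolding s'_def by (rule depol_spec[OF S])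
  have tpos: "t i > 0" if "i < d" for i using lam(1)[OF that] d by (simp add: t_def add_nonneg_pos)
  have spos: "s' i > 0" if "i < d" for i using mu(1)[OF that] d by (simp add: s'_def add_nonneg_pos)
  have tsum: "(\<Sum>i<d. t i) = 1"
    unfolding t_def sum_divide_distrib[symmetric] sum.distrib lam(2) using d by simp
  have Mt: "\<bar>log2_supp (t i)\<bar> \<le> M" if "i < d" for i
    unfolding t_def M_def using that d lam by (intro abs_log_depol) auto
  have Ms: "\<bar>log2_supp (s' i)\<bar> \<le> M" if "i < d" for i
    unfolding s'_def M_def using that d mu by (intro abs_log_depol) auto
  have lin: "\<bar>(\<Sum>j<d. 1 * qf d wb (v j)) - (\<Sum>j<d. 1 * qf d w (v j))\<bar> \<le> 1 * e"
    by (rule expectation_trace_norm_bound[OF hwb hw spec_onb[OF S] _ dist]) auto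
  have om_sum: "(\<Sum>i<d. om i) \<ge> 1 - e" "(\<Sum>i<d. om i) \<le> 1"
    using lin mtrace_onb[OF hermitian_carrier[OF hwb] spec_onb[OF S]]
      mtrace_onb[OF hermitian_carrier[OF hw] spec_onb[OF S]] spec_mtrace[OF WB] spec_mtrace[OF W] lam(2) tr
    by auto
  have wle: "qf d wb x \<le> l * qf d s x" for x using le mat_le_iff[OF hwb hs] by blast
  have qfS: "0 \<le> qf d s x" "qf d s x \<le> 2 * qf d (depol d s) x" for x
  proof -
    show "0 \<le> qf d s x" using s by (simp add: state_mat_def psd_mat_iff)
    show "qf d s x \<le> 2 * qf d (depol d s) x"
      unfolding qf_spec[OF S] qf_spec[OF S'] sum_distrib_left
      by (intro sum_mono) (auto simp: s'_def algebra_simps)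
  qed
  have wle': "qf d wb x \<le> (2 * l) * qf d (depol d s) x" for x
    using order_trans[OF wle[of x] mult_left_mono[OF qfS(2)[of x], of l]] l by (simp add: mult_ac)
  have "1 - e \<le> l"
  proof -
    have "(\<Sum>j<d. qf d wb (v j)) \<le> (\<Sum>j<d. l * qf d s (v j))" by (intro sum_mono wle)
    also have "\<dots> = l" unfolding sum_distrib_left[symmetric]
      using mtrace_onb[OF hermitian_carrier[OF hs] spec_onb[OF S]] spec_mtrace[OF S] mu(2) by simp
    finally show ?thesis
      using om_sum mtrace_onb[OF hermitian_carrier[OF hwb] spec_onb[OF S]] spec_mtrace[OF WB] by simp
  qed
  then have "log 2 (2 * l) \<ge> 0" using e by simp
  then have lo: "log 2 (2 * l) * (\<Sum>i<d. om i) \<le> 1 + log 2 l"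
    using mult_left_mono[OF om_sum(2), of "log 2 (2 * l)"] l by (simp add: log_mult)
  define Hw where "Hw = (\<Sum>i<d. lam i * log2_supp (lam i))"
  define Hb where "Hb = (\<Sum>i<d. om i * log2_supp (om i))"
  have 5: "Hb - (\<Sum>j<d. log2_supp (s' j) * qf d wb (v j)) \<le> 1 + log 2 l"
    using rel_entropy_le_log[OF WB S' om spos wle'] l lo by (simp add: Hb_def)
  have 1: "\<bar>(\<Sum>j<d. log2_supp (s' j) * qf d wb (v j)) - (\<Sum>j<d. log2_supp (s' j) * qf d w (v j))\<bar> \<le> M * e"
    by (rule expectation_trace_norm_bound[OF hwb hw spec_onb[OF S] _ dist]) (use Ms M in auto)
  have 3: "\<bar>(\<Sum>j<d. log2_supp (t j) * qf d wb (u j)) - (\<Sum>j<d. log2_supp (t j) * qf d w (u j))\<bar> \<le> M * e"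
    by (rule expectation_trace_norm_bound[OF hwb hw spec_onb[OF W] _ dist]) (use Mt M in auto)
  have 2: "Hb - (\<Sum>j<d. log2_supp (t j) * qf d wb (u j)) \<ge> - 1"
  proof -
    have ln2: "ln 2 \<ge> (1/2 :: real)" using ln2_ge_two_thirds by simp
    have "- e / ln 2 \<le> ((\<Sum>i<d. om i) - (\<Sum>j<d. t j)) / ln 2"
      using om_sum tsum by (intro divide_right_mono) auto
    also have "\<dots> \<le> Hb - (\<Sum>j<d. log2_supp (t j) * qf d wb (u j))"
      unfolding Hb_def by (rule klein_inequality[OF WB T om tpos])
    finally have "- e / ln 2 \<le> Hb - (\<Sum>j<d. log2_supp (t j) * qf d wb (u j))" .
    moreover have "- 1 \<le> - e / ln 2" using e ln2 by (simp add: field_simps)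
    ultimately show ?thesis by linarith
  qed
  have 4: "(\<Sum>j<d. log2_supp (t j) * qf d w (u j)) \<ge> Hw - 1"
  proof -
    have "lam i * log2_supp (lam i) - lam i \<le> log2_supp (t i) * lam i" if "i < d" for i
    proof (cases "lam i = 0")
      case False
      then have p: "lam i > 0" using lam(1)[OF that] by simp
      have "log 2 (lam i / 2) \<le> log 2 (t i)"
        using p tpos[OF that] d by (subst log_le_cancel_iff) (auto simp: t_def)
      then have "lam i * (log 2 (lam i) - 1) \<le> lam i * log 2 (t i)"
        using p by (intro mult_left_mono) (auto simp: log_divide)
      then show ?thesis using p tpos[OF that] by (simp add: log2_supp_def algebra_simps)
    qed simp
    then have "(\<Sum>i<d. lam i * log2_supp (lam i) - lam i) \<le> (\<Sum>i<d. log2_supp (t i) * lam i)"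
      by (intro sum_mono) auto
    then show ?thesis using qf_eigenvector[OF W] lam(2) by (simp add: Hw_def sum_subtractf)
  qed
  have "Hw - (\<Sum>j<d. log2_supp (s' j) * qf d w (v j)) \<le> log 2 l + 2 * (M * e) + 3"
    using 1 2 3 4 5 unfolding abs_le_iff by linarith
  then show ?thesis
    unfolding rel_entropy_def using spec_pos_supp_le[OF S' spos spec_carrier[OF W]]
      rel_entropy_spec[OF W S'] by (simp add: Hw_def M_def mult_ac)
qed

section \<open>Typical projections\<close>

text \<open>A weighted arithmetic-geometric mean inequality with free parameter \<open>t\<close>. It
  stands in for Cauchy-Schwarz in the gentle-measurement estimate, and its right side can be summed
  over a basis by Parseval.\<close>

lemma abs_cmod_square_diff_le:
  assumes "t > 0"
  shows "\<bar>(cmod p)\<^sup>2 - (cmod q)\<^sup>2\<bar> \<le> t * ((cmod p)\<^sup>2 + (cmod q)\<^sup>2) + (cmod (p - q))\<^sup>2 / (2 * t)"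
proof -
  define x y z where "x = cmod p" and "y = cmod q" and "z = cmod (p - q)"
  have z: "\<bar>x - y\<bar> \<le> z" unfolding x_def y_def z_def by (rule norm_triangle_ineq3)
  have "\<bar>x\<^sup>2 - y\<^sup>2\<bar> = \<bar>x - y\<bar> * (x + y)"
    by (simp add: x_def y_def power2_eq_square square_diff_square_factored abs_mult mult.commute)
  also have "\<dots> \<le> z * (x + y)" using z by (intro mult_right_mono) (auto simp: x_def y_def)
  also have "\<dots> \<le> t * (x\<^sup>2 + y\<^sup>2) + z\<^sup>2 / (2 * t)"
  proof -
    \<comment> \<open>This sum of squares is \<open>2 * t\<close> times the difference of the two
      sides.\<close>
    have "0 \<le> (t * (x + y) - z)\<^sup>2 + (t * (x - y))\<^sup>2" by simp
    then have "2 * t * (z * (x + y)) \<le> 2 * t * (t * (x\<^sup>2 + y\<^sup>2) + z\<^sup>2 / (2 * t))"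
      using assms by (simp add: power2_eq_square algebra_simps)
    then show ?thesis using assms by (simp add: mult_le_cancel_left)
  qed
  finally show ?thesis by (simp add: x_def y_def z_def)
qed

text \<open>The subnormalized state is \<open>Q P w P Q\<close> for the spectral projections \<open>P\<close> of \<open>w\<close> onto
  eigenvalues \<open>\<le> a\<close> and \<open>Q\<close> of \<open>s\<close> onto eigenvalues \<open>\<ge> b\<close>; closeness is the
  gentle-measurement argument.\<close>

lemma typical_truncation:
  assumes W: "spec d w u lam" and S: "spec d s v mu"
    and lam: "\<And>i. i < d \<Longrightarrow> lam i \<ge> 0" "(\<Sum>i<d. lam i) = 1" and mu: "\<And>j. j < d \<Longrightarrow> mu j \<ge> 0"
    and a: "a > 0" and b: "b > 0" and e: "e > 0"
    and h1: "(\<Sum>i\<in>{i. i < d \<and> lam i > a}. lam i) \<le> e\<^sup>2 / 8"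
    and h2: "(\<Sum>j\<in>{j. j < d \<and> mu j < b}. qf d w (v j)) \<le> e\<^sup>2 / 8"
  shows "\<exists>wb\<in>smooth_ball d e w. mat_le d wb (complex_of_real (a / b) \<cdot>\<^sub>m s)"
proof -
  note u = spec_onb[OF W] and v = spec_onb[OF S]
  have cmod_sym: "cmod (cip d x y) = cmod (cip d y x)" for x y by (metis cip_cnj complex_mod_cnj)
  define Q where "Q x = (\<lambda>c. \<Sum>j<d. (of_bool (mu j \<ge> b) * cip d (v j) x) * v j c)" for x
  \<comment> \<open>These are the vectors Q P u_i; P is diagonal in the basis \<open>u\<close> and
    therefore a mere cutoff on \<open>i\<close>.\<close>
  define k where "k i = (if lam i \<le> a then Q (u i) else (\<lambda>_. 0))" for i
  define wb where "wb = Matrix.mat d d (\<lambda>(r,c). \<Sum>i<d. of_real (lam i) * k i r * cnj (k i c))"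
  have vQ: "cip d (v j) (Q x) = of_bool (mu j \<ge> b) * cip d (v j) x" if "j < d" for j x
  proof -
    have "cip d (v j) (Q x) = (\<Sum>l<d. (of_bool (mu l \<ge> b) * cip d (v l) x) * cip d (v j) (v l))"
      unfolding Q_def cip_sum_right ..
    also have "\<dots> = (\<Sum>l<d. (of_bool (mu l \<ge> b) * cip d (v l) x) * of_bool (j = l))"
      using that by (intro sum.cong refl) (simp add: onbD[OF v])
    also have "\<dots> = of_bool (mu j \<ge> b) * cip d (v j) x" using that by (rule sum_of_bool_mult)
    finally show ?thesis .
  qed
  have Q_sym: "cip d (Q x) y = cip d x (Q y)" for x y
  proof -
    have "cip d (Q x) y = (\<Sum>j<d. cnj (of_bool (mu j \<ge> b) * cip d (v j) x) * cip d (v j) y)"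
      unfolding onb_parseval_cip[OF v, of "Q x"] by (intro sum.cong refl) (simp add: vQ)
    also have "\<dots> = cip d x (Q y)"
      unfolding onb_parseval_cip[OF v, of x] by (intro sum.cong refl) (auto simp: vQ)
    finally show ?thesis .
  qed
  have vk: "cip d (v j) (k i) = of_bool (lam i \<le> a \<and> mu j \<ge> b) * cip d (v j) (u i)"
    if "j < d" for i j
    using vQ[OF that] by (auto simp: k_def) (simp add: cip_def)
  have nk: "nrm2 d (k i) \<le> 1" if "i < d" for i
  proof -
    have "nrm2 d (k i) = (\<Sum>j<d. (cmod (cip d (v j) (k i)))\<^sup>2)" by (simp add: onb_parseval[OF v])
    also have "\<dots> \<le> (\<Sum>j<d. (cmod (cip d (v j) (u i)))\<^sup>2)"
      by (intro sum_mono) (simp add: vk)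
    also have "\<dots> = 1" unfolding onb_parseval[OF v] by (rule nrm2_onb[OF u that])
    finally show ?thesis .
  qed
  have herm: "hermitian_mat d wb"
    unfolding hermitian_mat_iff by (auto simp: wb_def mult_ac)
  have qwb: "qf d wb x = (\<Sum>i<d. lam i * (cmod (cip d (k i) x))\<^sup>2)" for x
    by (rule qf_rank_one_sum) (simp add: wb_def)
  have psd: "psd_mat d wb"
    unfolding psd_mat_iff qwb using herm lam(1) by (auto intro!: sum_nonneg)
  \<comment> \<open>The two cutoffs give the two factors: P w P <= a I and Q <= s / b.\<close>
  have le: "qf d wb x \<le> (a / b) * qf d s x" for x
  proof -
    have "qf d wb x \<le> (\<Sum>i<d. a * (cmod (cip d (u i) (Q x)))\<^sup>2)"
      unfolding qwb
    proof (intro sum_mono)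
      fix i assume i: "i \<in> {..<d}"
      show "lam i * (cmod (cip d (k i) x))\<^sup>2 \<le> a * (cmod (cip d (u i) (Q x)))\<^sup>2"
      proof (cases "lam i \<le> a")
        case True
        then show ?thesis by (simp add: k_def Q_sym mult_right_mono)
      qed (use a in \<open>simp add: k_def cip_def\<close>)
    qed
    also have "\<dots> = a * (\<Sum>j<d. (cmod (cip d (v j) (Q x)))\<^sup>2)"
      unfolding sum_distrib_left[symmetric] onb_parseval[OF u] onb_parseval[OF v] ..
    also have "\<dots> \<le> a * (\<Sum>j<d. (mu j / b) * (cmod (cip d (v j) x))\<^sup>2)"
    proof (intro mult_left_mono sum_mono)
      fix j assume "j \<in> {..<d}"
      then have j: "j < d" by simp
      show "(cmod (cip d (v j) (Q x)))\<^sup>2 \<le> (mu j / b) * (cmod (cip d (v j) x))\<^sup>2"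
      proof (cases "mu j \<ge> b")
        case True
        then have "1 \<le> mu j / b" using b by simp
        then have "1 * (cmod (cip d (v j) x))\<^sup>2 \<le> (mu j / b) * (cmod (cip d (v j) x))\<^sup>2"
          by (intro mult_right_mono) auto
        then show ?thesis using True by (simp add: vQ[OF j])
      qed (use b mu[OF j] in \<open>simp add: vQ[OF j]\<close>)
    qed (use a in simp)
    also have "\<dots> = (a / b) * qf d s x"
      unfolding qf_spec[OF S] sum_distrib_left by (simp add: mult_ac)
    finally show ?thesis .
  qed
  have tr: "Re (mtrace wb) \<le> Re (mtrace w)"
  proof -
    have "Re (mtrace wb) = (\<Sum>j<d. \<Sum>i<d. lam i * (cmod (cip d (k i) (v j)))\<^sup>2)"
      using mtrace_onb[OF hermitian_carrier[OF herm] v] by (simp add: qwb)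
    also have "\<dots> = (\<Sum>i<d. lam i * (\<Sum>j<d. (cmod (cip d (v j) (k i)))\<^sup>2))"
      unfolding sum_distrib_left cmod_sym[of "k _"] by (rule sum.swap)
    also have "\<dots> \<le> (\<Sum>i<d. lam i * 1)"
      unfolding onb_parseval[OF v] using lam(1) nk by (intro sum_mono mult_left_mono) auto
    finally show ?thesis by (simp add: spec_mtrace[OF W])
  qed
  \<comment> \<open>The average squared displacement of u_i under Q P is at most the weight removed
    by P plus the weight removed by Q, which are bounded by \<open>h1\<close> and
    \<open>h2\<close>.\<close>
  have dev: "(\<Sum>i<d. lam i * nrm2 d (\<lambda>c. k i c - u i c)) \<le> e\<^sup>2 / 4"
  proof -
    have "nrm2 d (\<lambda>c. k i c - u i c)
        \<le> of_bool (lam i > a) + (\<Sum>j<d. of_bool (mu j < b) * (cmod (cip d (u i) (v j)))\<^sup>2)" if i: "i < d" for i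
    proof -
      have "nrm2 d (\<lambda>c. k i c - u i c) = (\<Sum>j<d. (cmod (cip d (v j) (k i) - cip d (v j) (u i)))\<^sup>2)"
        by (simp add: onb_parseval[OF v, symmetric] cip_diff_right)
      also have "\<dots> = (\<Sum>j<d. of_bool (lam i > a \<or> mu j < b) * (cmod (cip d (v j) (u i)))\<^sup>2)"
        by (intro sum.cong refl) (auto simp: vk)
      also have "\<dots> \<le> (\<Sum>j<d. of_bool (lam i > a) * (cmod (cip d (v j) (u i)))\<^sup>2
          + of_bool (mu j < b) * (cmod (cip d (v j) (u i)))\<^sup>2)"
        by (intro sum_mono) auto
      also have "\<dots> = of_bool (lam i > a) * nrm2 d (u i) + (\<Sum>j<d. of_bool (mu j < b) * (cmod (cip d (v j) (u i)))\<^sup>2)"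
        unfolding sum.distrib sum_distrib_left[symmetric] onb_parseval[OF v] ..
      finally show ?thesis using nrm2_onb[OF u i] by (simp add: cmod_sym[of "v _"])
    qed
    then have "(\<Sum>i<d. lam i * nrm2 d (\<lambda>c. k i c - u i c)) \<le> (\<Sum>i<d. lam i *
        (of_bool (lam i > a) + (\<Sum>j<d. of_bool (mu j < b) * (cmod (cip d (u i) (v j)))\<^sup>2)))"
      using lam(1) by (intro sum_mono mult_left_mono) auto
    also have "\<dots> = (\<Sum>i<d. of_bool (lam i > a) * lam i)
        + (\<Sum>i<d. \<Sum>j<d. of_bool (mu j < b) * (lam i * (cmod (cip d (u i) (v j)))\<^sup>2))"
      unfolding distrib_left sum.distrib sum_distrib_left
      by (intro arg_cong2[of _ _ _ _ "(+)"] sum.cong refl) (simp_all only: mult_ac)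
    also have "(\<Sum>i<d. \<Sum>j<d. of_bool (mu j < b) * (lam i * (cmod (cip d (u i) (v j)))\<^sup>2))
        = (\<Sum>j<d. of_bool (mu j < b) * qf d w (v j))"
      unfolding qf_spec[OF W] sum_distrib_left by (rule sum.swap)
    also have "(\<Sum>i<d. of_bool (lam i > a) * lam i) = (\<Sum>i\<in>{i. i < d \<and> lam i > a}. lam i)"
      by (rule sum.mono_neutral_cong_right) auto
    also have "(\<Sum>j<d. of_bool (mu j < b) * qf d w (v j)) = (\<Sum>j\<in>{j. j < d \<and> mu j < b}. qf d w (v j))"
      by (rule sum.mono_neutral_cong_right) auto
    finally show ?thesis using h1 h2 by simp
  qed
  have hX: "hermitian_mat d (wb - w)" by (rule hermitian_diff[OF herm spec_hermitian[OF W]])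
  then obtain z x where X: "spec d (wb - w) z x" using hermitian_spec by blast
  note z = spec_onb[OF X]
  have "trace_norm d (wb - w) \<le> e"
  proof -
    \<comment> \<open>This balances the two contributions of \<open>abs_cmod_square_diff_le\<close>:
      2 t and (e^2/4)/(2 t) are both e/2.\<close>
    define t where "t = e / 4"
    have t: "t > 0" using e by (simp add: t_def)
    have "trace_norm d (wb - w) = (\<Sum>l<d. \<bar>qf d (wb - w) (z l)\<bar>)"
      using qf_eigenvector[OF X] by (simp add: trace_norm_spec[OF X])
    also have "\<dots> = (\<Sum>l<d. \<bar>\<Sum>i<d. lam i * ((cmod (cip d (k i) (z l)))\<^sup>2 - (cmod (cip d (u i) (z l)))\<^sup>2)\<bar>)"
      unfolding qf_diff[OF hermitian_carrier[OF herm] spec_carrier[OF W]] qwb qf_spec[OF W]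
      by (simp add: sum_subtractf algebra_simps)
    also have "\<dots> \<le> (\<Sum>l<d. \<Sum>i<d. lam i * \<bar>(cmod (cip d (k i) (z l)))\<^sup>2 - (cmod (cip d (u i) (z l)))\<^sup>2\<bar>)"
      using lam(1) by (intro sum_mono order_trans[OF sum_abs]) (auto simp: abs_mult)
    also have "\<dots> = (\<Sum>i<d. lam i * (\<Sum>l<d. \<bar>(cmod (cip d (k i) (z l)))\<^sup>2 - (cmod (cip d (u i) (z l)))\<^sup>2\<bar>))"
      unfolding sum_distrib_left by (rule sum.swap)
    also have "\<dots> \<le> (\<Sum>i<d. lam i * (2 * t + nrm2 d (\<lambda>c. k i c - u i c) / (2 * t)))"
    proof (intro sum_mono mult_left_mono)
      fix i assume "i \<in> {..<d}"
      then have i: "i < d" by simp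
      have "(\<Sum>l<d. \<bar>(cmod (cip d (k i) (z l)))\<^sup>2 - (cmod (cip d (u i) (z l)))\<^sup>2\<bar>)
          = (\<Sum>l<d. \<bar>(cmod (cip d (z l) (k i)))\<^sup>2 - (cmod (cip d (z l) (u i)))\<^sup>2\<bar>)"
        by (simp add: cmod_sym[of _ "z _"])
      also have "\<dots> \<le> (\<Sum>l<d. t * ((cmod (cip d (z l) (k i)))\<^sup>2 + (cmod (cip d (z l) (u i)))\<^sup>2)
          + (cmod (cip d (z l) (\<lambda>c. k i c - u i c)))\<^sup>2 / (2 * t))"
        unfolding cip_diff_right by (intro sum_mono abs_cmod_square_diff_le t)
      also have "\<dots> = t * (nrm2 d (k i) + nrm2 d (u i)) + nrm2 d (\<lambda>c. k i c - u i c) / (2 * t)"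
        unfolding sum.distrib sum_distrib_left[symmetric] sum_divide_distrib[symmetric] onb_parseval[OF z] ..
      also have "\<dots> \<le> t * (1 + 1) + nrm2 d (\<lambda>c. k i c - u i c) / (2 * t)"
        using t nk[OF i] nrm2_onb[OF u i] by (intro add_right_mono mult_left_mono add_mono) auto
      finally show "(\<Sum>l<d. \<bar>(cmod (cip d (k i) (z l)))\<^sup>2 - (cmod (cip d (u i) (z l)))\<^sup>2\<bar>)
        \<le> 2 * t + nrm2 d (\<lambda>c. k i c - u i c) / (2 * t)" by simp
    qed (use lam in auto)
    also have "\<dots> = 2 * t * (\<Sum>i<d. lam i) + (\<Sum>i<d. lam i * nrm2 d (\<lambda>c. k i c - u i c)) / (2 * t)"
      by (simp add: distrib_left sum.distrib sum_distrib_left sum_divide_distrib mult_ac)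
    also have "\<dots> \<le> 2 * t * 1 + (e\<^sup>2 / 4) / (2 * t)"
      using lam(2) dev t by (intro add_mono divide_right_mono) auto
    also have "\<dots> = e" using e by (simp add: t_def power2_eq_square field_simps)
    finally show ?thesis .
  qed
  then have "wb \<in> smooth_ball d e w" using psd tr by (simp add: smooth_ball_def)
  moreover have "mat_le d wb (complex_of_real (a / b) \<cdot>\<^sub>m s)"
    using mat_le_iff[OF herm spec_hermitian[OF S]] le by blast
  ultimately show ?thesis by blast
qed

section \<open>Means and variances of log-eigenvalues\<close>

definition moments :: "nat \<Rightarrow> (nat \<Rightarrow> real) \<Rightarrow> (nat \<Rightarrow> real) \<Rightarrow> real \<Rightarrow> real \<Rightarrow> bool" where
  "moments d p X m V \<longleftrightarrow> (\<forall>i<d. p i \<ge> 0) \<and> (\<Sum>i<d. p i) = 1 \<and>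
     (\<Sum>i<d. p i * X i) = m \<and> (\<Sum>i<d. p i * (X i - m)\<^sup>2) = V"

lemma moments_chebyshev:
  assumes st: "moments d p X m V" and t: "t > 0" and B: "B \<subseteq> {..<d}" "\<And>i. i \<in> B \<Longrightarrow> \<bar>X i - m\<bar> \<ge> t"
  shows "(\<Sum>i\<in>B. p i) \<le> V / t\<^sup>2"
proof -
  have p: "p i \<ge> 0" if "i < d" for i using st that by (simp add: moments_def)
  have "t\<^sup>2 * (\<Sum>i\<in>B. p i) \<le> (\<Sum>i\<in>B. p i * (X i - m)\<^sup>2)"
    unfolding sum_distrib_left
  proof (rule sum_mono)
    fix i assume i: "i \<in> B"
    then have "t\<^sup>2 \<le> (X i - m)\<^sup>2" using B(2)[OF i] t by (metis abs_le_square_iff abs_of_pos)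
    then show "t\<^sup>2 * p i \<le> p i * (X i - m)\<^sup>2" using p B(1) i by (simp add: mult.commute mult_left_mono subset_eq)
  qed
  also have "\<dots> \<le> (\<Sum>i<d. p i * (X i - m)\<^sup>2)" using B(1) p by (intro sum_mono2) auto
  also have "\<dots> = V" using st by (simp add: moments_def)
  finally show ?thesis using t by (simp add: field_simps)
qed

text \<open>The first distribution is the spectrum of \<open>w\<close>, the second the diagonal of
  \<open>w\<close> in the eigenbasis of \<open>s\<close>. The means are Tr w log w and Tr w log s,
  so \<open>m1 - m2\<close> is the relative entropy.\<close>

definition log_moments :: "nat \<Rightarrow> complex mat \<Rightarrow> complex mat \<Rightarrow> real \<Rightarrow> real \<Rightarrow> real \<Rightarrow> real \<Rightarrow> bool" where
  "log_moments d w s m1 v1 m2 v2 \<longleftrightarrow> (\<exists>u lam v mu. spec d w u lam \<and> spec d s v mu \<and> (\<forall>j<d. mu j > 0) \<and>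
     moments d lam (\<lambda>i. log2_supp (lam i)) m1 v1 \<and>
     moments d (\<lambda>j. qf d w (v j)) (\<lambda>j. log2_supp (mu j)) m2 v2)"

text \<open>The thresholds lie \<open>t\<close> beyond the means, \<open>a\<close> above the first
  and \<open>b\<close> below the second, whence log(a/b) is \<open>m1 - m2 + 2 * t\<close>.
  Chebyshev turns the variance bounds into the tail weights that \<open>typical_truncation\<close>
  asks for.\<close>

lemma log_moments_D_max_smooth:
  assumes g: "log_moments d w s m1 v1 m2 v2" and t: "t > 0" and e: "e > 0"
    and v: "v1 \<le> t\<^sup>2 * e\<^sup>2 / 8" "v2 \<le> t\<^sup>2 * e\<^sup>2 / 8"
  shows "D_max_smooth d e w s \<le> ereal (m1 - m2 + 2 * t)"
proof -
  obtain u lam v mu where W: "spec d w u lam" and S: "spec d s v mu" and mu: "\<And>j. j < d \<Longrightarrow> mu j > 0"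
    and st1: "moments d lam (\<lambda>i. log2_supp (lam i)) m1 v1"
    and st2: "moments d (\<lambda>j. qf d w (v j)) (\<lambda>j. log2_supp (mu j)) m2 v2"
    using g unfolding log_moments_def by blast
  define a where "a = 2 powr (m1 + t)"
  define b where "b = 2 powr (m2 - t)"
  have ab: "a > 0" "b > 0" by (auto simp: a_def b_def)
  have la: "log 2 a = m1 + t" "log 2 b = m2 - t" by (auto simp: a_def b_def)
  have "(\<Sum>i\<in>{i. i < d \<and> lam i > a}. lam i) \<le> v1 / t\<^sup>2"
  proof (rule moments_chebyshev[OF st1 t])
    fix i assume "i \<in> {i. i < d \<and> lam i > a}"
    then have i: "lam i > a" by simp
    then have "log 2 a \<le> log 2 (lam i)" using ab by (subst log_le_cancel_iff) auto
    then show "t \<le> \<bar>log2_supp (lam i) - m1\<bar>" using ab i la by (simp add: log2_supp_def)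
  qed auto
  also have "\<dots> \<le> e\<^sup>2 / 8" using v(1) t by (simp add: field_simps)
  finally have h1: "(\<Sum>i\<in>{i. i < d \<and> lam i > a}. lam i) \<le> e\<^sup>2 / 8" .
  have "(\<Sum>j\<in>{j. j < d \<and> mu j < b}. qf d w (v j)) \<le> v2 / t\<^sup>2"
  proof (rule moments_chebyshev[OF st2 t])
    fix j assume "j \<in> {j. j < d \<and> mu j < b}"
    then have j: "mu j < b" "mu j > 0" using mu by auto
    then have "log 2 (mu j) \<le> log 2 b" using ab by (subst log_le_cancel_iff) auto
    then show "t \<le> \<bar>log2_supp (mu j) - m2\<bar>" using ab j la by (simp add: log2_supp_def)
  qed auto
  also have "\<dots> \<le> e\<^sup>2 / 8" using v(2) t by (simp add: field_simps)
  finally have h2: "(\<Sum>j\<in>{j. j < d \<and> mu j < b}. qf d w (v j)) \<le> e\<^sup>2 / 8" .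
  have "\<exists>wb\<in>smooth_ball d e w. mat_le d wb (complex_of_real (a / b) \<cdot>\<^sub>m s)"
    using st1 mu by (intro typical_truncation[OF W S _ _ _ ab e h1 h2]) (auto simp: moments_def less_imp_le)
  then obtain wb where wb: "wb \<in> smooth_ball d e w" "mat_le d wb (complex_of_real (a / b) \<cdot>\<^sub>m s)"
    by blast
  have "D_max_smooth d e w s \<le> D_max d wb s"
    unfolding D_max_smooth_def by (rule INF_lower[OF wb(1)])
  also have "\<dots> \<le> ereal (log 2 (a / b))"
    unfolding D_max_def using wb(2) ab by (intro INF_lower) auto
  also have "log 2 (a / b) = m1 - m2 + 2 * t" using ab la by (simp add: log_divide)
  finally show ?thesis .
qed

text \<open>On the kernel of \<open>s\<close>, \<open>log2_supp\<close> returns the default 0 in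
  place of minus infinity. The support condition gives \<open>w\<close> no weight there, which makes
  the default harmless.\<close>

lemma supp_le_eigenvector:
  assumes S: "spec d s v mu" and W: "w \<in> carrier_mat d d" and supp: "supp_le d w s"
    and j: "j < d" "mu j = 0"
  shows "qf d w (v j) = 0"
proof -
  let ?x = "Matrix.vec d (v j)"
  have "s *\<^sub>v ?x = 0\<^sub>v d"
  proof (rule eq_vecI)
    fix a assume "a < dim_vec (0\<^sub>v d :: complex vec)"
    then have a: "a < d" by simp
    have "(s *\<^sub>v ?x) $ a = (\<Sum>b<d. s $$ (a,b) * v j b)"
      using a spec_carrier[OF S] by (simp add: scalar_prod_def atLeast0LessThan)
    then show "(s *\<^sub>v ?x) $ a = 0\<^sub>v d $ a" using spec_eigenvector[OF S j(1) a] j a by simp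
  qed (use spec_carrier[OF S] in auto)
  then have "w *\<^sub>v ?x = 0\<^sub>v d" using supp by (simp add: supp_le_def)
  then have "qf d w (\<lambda>a. ?x $ a) = 0" using qf_vec[OF W, of ?x] by simp
  also have "qf d w (\<lambda>a. ?x $ a) = qf d w (v j)" by (intro qf_cong) simp
  finally show ?thesis .
qed

text \<open>The extra 1 is the bit lost by mixing: every eigenvalue of \<open>depol d s\<close> is
  at least half that of \<open>s\<close>, and where the latter is zero \<open>w\<close> has no
  weight.\<close>

lemma log_moments_depol:
  assumes d: "d > 0" and w: "state_mat d w" and s: "state_mat d s" and supp: "supp_le d w s"
  shows "\<exists>m1 v1 m2 v2. log_moments d w (depol d s) m1 v1 m2 v2 \<and> ereal (m1 - m2) \<le> rel_entropy d w s + 1"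
proof -
  obtain u lam where W: "spec d w u lam" and lam: "\<And>i. i < d \<Longrightarrow> lam i \<ge> 0" "(\<Sum>i<d. lam i) = 1"
    "\<And>i. i < d \<Longrightarrow> lam i \<le> 1" using state_spec[OF w] by blast
  obtain v mu where S: "spec d s v mu" and mu: "\<And>i. i < d \<Longrightarrow> mu i \<ge> 0" "(\<Sum>i<d. mu i) = 1"
    "\<And>i. i < d \<Longrightarrow> mu i \<le> 1" using state_spec[OF s] by blast
  define s' where "s' i = (mu i + 1 / real d) / 2" for i
  have S': "spec d (depol d s) v s'" unfolding s'_def by (rule depol_spec[OF S])
  have spos: "s' i > 0" if "i < d" for i using mu(1)[OF that] d by (simp add: s'_def add_nonneg_pos)
  have q0: "qf d w x \<ge> 0" for x using w by (simp add: state_mat_def psd_mat_iff)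
  have q1: "(\<Sum>j<d. qf d w (v j)) = 1"
    using mtrace_onb[OF spec_carrier[OF W] spec_onb[OF S]] w by (simp add: state_mat_def)
  define m1 where "m1 = (\<Sum>i<d. lam i * log2_supp (lam i))"
  define m2 where "m2 = (\<Sum>j<d. qf d w (v j) * log2_supp (s' j))"
  have "log_moments d w (depol d s) m1 (\<Sum>i<d. lam i * (log2_supp (lam i) - m1)\<^sup>2)
      m2 (\<Sum>j<d. qf d w (v j) * (log2_supp (s' j) - m2)\<^sup>2)"
    unfolding log_moments_def
    by (rule exI[of _ u], rule exI[of _ lam], rule exI[of _ v], rule exI[of _ s'])
       (use W S' spos lam q0 q1 in \<open>auto simp: moments_def m1_def m2_def\<close>)
  moreover have "ereal (m1 - m2) \<le> rel_entropy d w s + 1"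
  proof -
    have "log2_supp (mu j) * qf d w (v j) - qf d w (v j) \<le> qf d w (v j) * log2_supp (s' j)"
      if "j < d" for j
    proof (cases "mu j = 0")
      case True
      then show ?thesis using supp_le_eigenvector[OF S spec_carrier[OF W] supp that] by simp
    next
      case False
      then have p: "mu j > 0" using mu(1)[OF that] by simp
      have "log 2 (mu j / 2) \<le> log 2 (s' j)"
        using p spos[OF that] d by (subst log_le_cancel_iff) (auto simp: s'_def)
      then have "qf d w (v j) * (log 2 (mu j) - 1) \<le> qf d w (v j) * log 2 (s' j)"
        using p q0 by (intro mult_left_mono) (auto simp: log_divide)
      then show ?thesis using p spos[OF that] by (simp add: log2_supp_def algebra_simps)
    qed
    then have "(\<Sum>j<d. log2_supp (mu j) * qf d w (v j) - qf d w (v j)) \<le> m2"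
      unfolding m2_def by (intro sum_mono) auto
    then have "m1 - m2 \<le> m1 - (\<Sum>j<d. log2_supp (mu j) * qf d w (v j)) + 1"
      using q1 by (simp add: sum_subtractf)
    moreover have "rel_entropy d w s = ereal (m1 - (\<Sum>j<d. log2_supp (mu j) * qf d w (v j)))"
      unfolding rel_entropy_def using supp rel_entropy_spec[OF W S] by (simp add: m1_def)
    ultimately show ?thesis by (simp add: one_ereal_def)
  qed
  ultimately show ?thesis by blast
qed

section \<open>Tensor products\<close>

text \<open>Identifies an index range with a product of two without fixing the encoding. It serves
  Kronecker products (div and mod), the regrouping of copies across the A|B cut, and the merging of
  two finite convex combinations.\<close>

definition pairing :: "nat \<Rightarrow> nat \<Rightarrow> nat \<Rightarrow> (nat \<Rightarrow> nat) \<Rightarrow> (nat \<Rightarrow> nat) \<Rightarrow> bool" where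
  "pairing N d1 d2 p q \<longleftrightarrow> bij_betw (\<lambda>i. (p i, q i)) {..<N} ({..<d1} \<times> {..<d2})"

definition tens :: "nat \<Rightarrow> (nat \<Rightarrow> nat) \<Rightarrow> (nat \<Rightarrow> nat) \<Rightarrow> complex mat \<Rightarrow> complex mat \<Rightarrow> complex mat" where
  "tens N p q X Y = Matrix.mat N N (\<lambda>(i,j). X $$ (p i, p j) * Y $$ (q i, q j))"

lemma pairingI:
  assumes "inj_on (\<lambda>i. (p i, q i)) {..<N}" "\<And>i. i < N \<Longrightarrow> p i < d1" "\<And>i. i < N \<Longrightarrow> q i < d2"
    and "N = d1 * d2"
  shows "pairing N d1 d2 p q"
proof -
  have "(\<lambda>i. (p i, q i)) ` {..<N} = {..<d1} \<times> {..<d2}"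
    by (rule card_subset_eq) (use assms in \<open>auto simp: card_image\<close>)
  then show ?thesis using assms(1) by (simp add: pairing_def bij_betw_def)
qed

lemma pairing_lt: "pairing N d1 d2 p q \<Longrightarrow> i < N \<Longrightarrow> p i < d1 \<and> q i < d2"
  unfolding pairing_def bij_betw_def by blast

lemma pairing_eq_iff:
  "pairing N d1 d2 p q \<Longrightarrow> i < N \<Longrightarrow> j < N \<Longrightarrow> p i = p j \<and> q i = q j \<longleftrightarrow> i = j"
  unfolding pairing_def bij_betw_def inj_on_def by blast

lemma pairing_sum:
  assumes "pairing N d1 d2 p q"
  shows "(\<Sum>i<N. F (p i) (q i)) = (\<Sum>x<d1. \<Sum>y<d2. F x y)"
  using sum.reindex_bij_betw[OF assms[unfolded pairing_def], of "\<lambda>(x,y). F x y"]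
  by (simp add: sum.cartesian_product)

lemma pairing_sum_mult:
  fixes f g :: "nat \<Rightarrow> 'a :: comm_semiring_1"
  assumes "pairing N d1 d2 p q"
  shows "(\<Sum>i<N. f (p i) * g (q i)) = (\<Sum>x<d1. f x) * (\<Sum>y<d2. g y)"
  by (simp add: pairing_sum[OF assms, of "\<lambda>x y. f x * g y"] sum_product)

lemma cip_pairing:
  assumes "pairing N d1 d2 p q"
  shows "cip N (\<lambda>a. x (p a) * y (q a)) (\<lambda>a. x' (p a) * y' (q a)) = cip d1 x x' * cip d2 y y'"
  unfolding cip_def pairing_sum_mult[OF assms, symmetric] by (simp add: mult_ac)

lemma onb_pairing:
  assumes P: "pairing N d1 d2 p q" and u: "onb d1 u" and v: "onb d2 v"
  shows "onb N (\<lambda>i a. u (p i) (p a) * v (q i) (q a))"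
proof (rule orthon_imp_onb, unfold orthon_def, intro allI impI)
  fix i j assume ij: "i < N" "j < N"
  show "cip N (\<lambda>a. u (p i) (p a) * v (q i) (q a)) (\<lambda>a. u (p j) (p a) * v (q j) (q a)) = of_bool (i = j)"
    unfolding cip_pairing[OF P] using pairing_lt[OF P ij(1)] pairing_lt[OF P ij(2)] pairing_eq_iff[OF P ij]
    by (auto simp: onbD[OF u] onbD[OF v])
qed

lemma spec_tens:
  assumes P: "pairing N d1 d2 p q" and X: "spec d1 X u lam" and Y: "spec d2 Y v mu"
  shows "spec N (tens N p q X Y) (\<lambda>i a. u (p i) (p a) * v (q i) (q a)) (\<lambda>i. lam (p i) * mu (q i))"
proof -
  have "tens N p q X Y $$ (a,b) = (\<Sum>i<N. of_real (lam (p i) * mu (q i)) * (u (p i) (p a) * v (q i) (q a))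
      * cnj (u (p i) (p b) * v (q i) (q b)))" if "a < N" "b < N" for a b
  proof -
    have "tens N p q X Y $$ (a,b) = (\<Sum>i<d1. of_real (lam i) * u i (p a) * cnj (u i (p b)))
        * (\<Sum>j<d2. of_real (mu j) * v j (q a) * cnj (v j (q b)))"
      using that pairing_lt[OF P] by (simp add: tens_def spec_index[OF X] spec_index[OF Y])
    also have "\<dots> = (\<Sum>i<N. (of_real (lam (p i)) * u (p i) (p a) * cnj (u (p i) (p b)))
        * (of_real (mu (q i)) * v (q i) (q a) * cnj (v (q i) (q b))))"
      by (rule pairing_sum_mult[OF P, symmetric])
    finally show ?thesis by (simp add: mult_ac)
  qed
  then show ?thesis
    using onb_pairing[OF P spec_onb[OF X] spec_onb[OF Y]] by (simp add: spec_def tens_def)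
qed

lemma qf_tens:
  assumes P: "pairing N d1 d2 p q" and X: "spec d1 X u lam" and Y: "spec d2 Y v mu"
  shows "qf N (tens N p q X Y) (\<lambda>a. x (p a) * y (q a)) = qf d1 X x * qf d2 Y y"
  unfolding qf_spec[OF spec_tens[OF assms]] qf_spec[OF X] qf_spec[OF Y] cip_pairing[OF P]
    pairing_sum_mult[OF P, symmetric]
  by (simp add: norm_mult power_mult_distrib mult_ac)

text \<open>Independence: the cross term factors into two centered sums and vanishes.
  \<open>Z\<close> is prescribed only where the weight is nonzero, because \<open>log2_supp\<close>
  sends 0 to 0 and is not additive when a factor is zero.\<close>

lemma moments_pairing:
  assumes P: "pairing N d1 d2 p q"
    and s1: "moments d1 f1 X1 m1 v1" and s2: "moments d2 f2 X2 m2 v2"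
    and Z: "\<And>i. i < N \<Longrightarrow> f1 (p i) * f2 (q i) \<noteq> 0 \<Longrightarrow> Z i = X1 (p i) + X2 (q i)"
  shows "moments N (\<lambda>i. f1 (p i) * f2 (q i)) Z (m1 + m2) (v1 + v2)"
proof -
  have f: "(\<Sum>i<d1. f1 i) = 1" "(\<Sum>i<d2. f2 i) = 1"
    and m: "(\<Sum>i<d1. f1 i * X1 i) = m1" "(\<Sum>i<d2. f2 i * X2 i) = m2"
    and v: "(\<Sum>i<d1. f1 i * (X1 i - m1)\<^sup>2) = v1" "(\<Sum>i<d2. f2 i * (X2 i - m2)\<^sup>2) = v2"
    and nn: "\<And>i. i < d1 \<Longrightarrow> f1 i \<ge> 0" "\<And>i. i < d2 \<Longrightarrow> f2 i \<ge> 0"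
    using s1 s2 by (auto simp: moments_def)
  have c: "(\<Sum>i<d1. f1 i * (X1 i - m1)) = 0" "(\<Sum>i<d2. f2 i * (X2 i - m2)) = 0"
    using f m by (simp_all add: right_diff_distrib sum_subtractf flip: sum_distrib_right)
  have 1: "(\<Sum>i<N. f1 (p i) * f2 (q i)) = 1"
    using f by (simp add: pairing_sum_mult[OF P])
  have "(\<Sum>i<N. f1 (p i) * f2 (q i) * Z i)
      = (\<Sum>i<N. (f1 (p i) * X1 (p i)) * f2 (q i) + f1 (p i) * (f2 (q i) * X2 (q i)))"
  proof (intro sum.cong refl)
    fix i assume "i \<in> {..<N}"
    then have i: "i < N" by simp
    show "f1 (p i) * f2 (q i) * Z i
      = (f1 (p i) * X1 (p i)) * f2 (q i) + f1 (p i) * (f2 (q i) * X2 (q i))"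
      using Z[OF i] by (cases "f1 (p i) * f2 (q i) = 0") (auto simp: algebra_simps)
  qed
  also have "\<dots> = m1 + m2"
    by (simp add: sum.distrib pairing_sum_mult[OF P] pairing_sum_mult[OF P, of "\<lambda>i. f1 i * X1 i"]
        pairing_sum_mult[OF P, of f1 "\<lambda>i. f2 i * X2 i"] f m)
  finally have 2: "(\<Sum>i<N. f1 (p i) * f2 (q i) * Z i) = m1 + m2" .
  have "(\<Sum>i<N. f1 (p i) * f2 (q i) * (Z i - (m1 + m2))\<^sup>2)
      = (\<Sum>i<N. (f1 (p i) * (X1 (p i) - m1)\<^sup>2) * f2 (q i) + f1 (p i) * (f2 (q i) * (X2 (q i) - m2)\<^sup>2)
          + 2 * ((f1 (p i) * (X1 (p i) - m1)) * (f2 (q i) * (X2 (q i) - m2))))"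
  proof (intro sum.cong refl)
    fix i assume "i \<in> {..<N}"
    then have i: "i < N" by simp
    show "f1 (p i) * f2 (q i) * (Z i - (m1 + m2))\<^sup>2
      = (f1 (p i) * (X1 (p i) - m1)\<^sup>2) * f2 (q i) + f1 (p i) * (f2 (q i) * (X2 (q i) - m2)\<^sup>2)
          + 2 * ((f1 (p i) * (X1 (p i) - m1)) * (f2 (q i) * (X2 (q i) - m2)))"
    proof (cases "f1 (p i) * f2 (q i) = 0")
      case False
      then show ?thesis unfolding Z[OF i False] by (simp add: power2_eq_square algebra_simps)
    qed auto
  qed
  also have "\<dots> = v1 + v2"
    unfolding sum.distrib sum_distrib_left[symmetric]
      pairing_sum_mult[OF P, of "\<lambda>i. f1 i * (X1 i - m1)\<^sup>2" f2]
      pairing_sum_mult[OF P, of f1 "\<lambda>i. f2 i * (X2 i - m2)\<^sup>2"]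
      pairing_sum_mult[OF P, of "\<lambda>i. f1 i * (X1 i - m1)" "\<lambda>i. f2 i * (X2 i - m2)"]
    by (simp add: f v c)
  finally have 3: "(\<Sum>i<N. f1 (p i) * f2 (q i) * (Z i - (m1 + m2))\<^sup>2) = v1 + v2" .
  have "f1 (p i) * f2 (q i) \<ge> 0" if "i < N" for i using nn pairing_lt[OF P that] by simp
  then show ?thesis using 1 2 3 by (simp add: moments_def)
qed

lemma log2_supp_mult: "x > 0 \<Longrightarrow> y > 0 \<Longrightarrow> log2_supp (x * y) = log2_supp x + log2_supp y"
  by (simp add: log2_supp_def log_mult)

text \<open>By \<open>qf_tens\<close> the diagonal of \<open>w1\<close> tensor \<open>w2\<close> in
  the product eigenbasis of \<open>s1\<close> and \<open>s2\<close> is again a product distribution,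
  as is the product spectrum; so both pairs of moments add.\<close>

lemma log_moments_tens:
  assumes P: "pairing N d1 d2 p q"
    and g1: "log_moments d1 w1 s1 m1 v1 m1' v1'" and g2: "log_moments d2 w2 s2 m2 v2 m2' v2'"
  shows "log_moments N (tens N p q w1 w2) (tens N p q s1 s2) (m1 + m2) (v1 + v2) (m1' + m2') (v1' + v2')"
proof -
  obtain u lam v mu where W1: "spec d1 w1 u lam" and S1: "spec d1 s1 v mu" and mu: "\<forall>j<d1. mu j > 0"
    and st1: "moments d1 lam (\<lambda>i. log2_supp (lam i)) m1 v1"
    and st1': "moments d1 (\<lambda>j. qf d1 w1 (v j)) (\<lambda>j. log2_supp (mu j)) m1' v1'"
    using g1 unfolding log_moments_def by blast
  obtain x al y be where W2: "spec d2 w2 x al" and S2: "spec d2 s2 y be" and be: "\<forall>j<d2. be j > 0"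
    and st2: "moments d2 al (\<lambda>i. log2_supp (al i)) m2 v2"
    and st2': "moments d2 (\<lambda>j. qf d2 w2 (y j)) (\<lambda>j. log2_supp (be j)) m2' v2'"
    using g2 unfolding log_moments_def by blast
  have lam: "\<forall>j<d1. lam j \<ge> 0" "\<forall>j<d2. al j \<ge> 0" using st1 st2 by (auto simp: moments_def)
  have A: "moments N (\<lambda>i. lam (p i) * al (q i)) (\<lambda>i. log2_supp (lam (p i) * al (q i))) (m1 + m2) (v1 + v2)"
    using pairing_lt[OF P] lam
    by (intro moments_pairing[OF P st1 st2] log2_supp_mult) (auto simp: less_le)
  have "moments N (\<lambda>i. qf d1 w1 (v (p i)) * qf d2 w2 (y (q i))) (\<lambda>i. log2_supp (mu (p i) * be (q i)))
      (m1' + m2') (v1' + v2')"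
    using pairing_lt[OF P] mu be
    by (intro moments_pairing[OF P st1' st2'] log2_supp_mult) auto
  then have B: "moments N (\<lambda>i. qf N (tens N p q w1 w2) (\<lambda>a. v (p i) (p a) * y (q i) (q a)))
      (\<lambda>i. log2_supp (mu (p i) * be (q i))) (m1' + m2') (v1' + v2')"
    unfolding qf_tens[OF P W1 W2] .
  show ?thesis
    unfolding log_moments_def
    by (intro exI conjI, rule spec_tens[OF P W1 W2], rule spec_tens[OF P S1 S2])
       (use A B pairing_lt[OF P] mu be in auto)
qed

lemma state_tens:
  assumes P: "pairing N d1 d2 p q" and X: "state_mat d1 X" and Y: "state_mat d2 Y"
  shows "state_mat N (tens N p q X Y)"
proof -
  obtain u lam where X': "spec d1 X u lam" "\<And>i. i < d1 \<Longrightarrow> lam i \<ge> 0" "(\<Sum>i<d1. lam i) = 1"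
    "\<And>i. i < d1 \<Longrightarrow> lam i \<le> 1" using state_spec[OF X] by blast
  obtain v mu where Y': "spec d2 Y v mu" "\<And>i. i < d2 \<Longrightarrow> mu i \<ge> 0" "(\<Sum>i<d2. mu i) = 1"
    "\<And>i. i < d2 \<Longrightarrow> mu i \<le> 1" using state_spec[OF Y] by blast
  have "mtrace (tens N p q X Y) = mtrace X * mtrace Y"
    using spec_carrier[OF X'(1)] spec_carrier[OF Y'(1)]
      pairing_sum_mult[OF P, of "\<lambda>i. X $$ (i,i)" "\<lambda>i. Y $$ (i,i)"]
    by (simp add: mtrace_def tens_def)
  then have "mtrace (tens N p q X Y) = 1" using X Y by (simp add: state_mat_def)
  moreover have "psd_mat N (tens N p q X Y)"
    using X'(2) Y'(2) pairing_lt[OF P] by (intro spec_psd[OF spec_tens[OF P X'(1) Y'(1)]]) auto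
  ultimately show ?thesis by (simp add: state_mat_def)
qed

lemma pairing_div_mod:
  assumes "d2 > 0"
  shows "pairing (d1 * d2) d1 d2 (\<lambda>i. i div d2) (\<lambda>i. i mod d2)"
proof (rule pairingI)
  show "inj_on (\<lambda>i. (i div d2, i mod d2)) {..<d1 * d2}"
    by (intro inj_onI) (metis Pair_inject div_mult_mod_eq)
qed (use assms in \<open>auto simp: less_mult_imp_div_less\<close>)

lemma kron_eq_tens:
  assumes "A \<in> carrier_mat d1 d1" "B \<in> carrier_mat d2 d2"
  shows "kron A B = tens (d1 * d2) (\<lambda>i. i div d2) (\<lambda>i. i mod d2) A B"
  using assms by (simp add: kron_def tens_def)

lemma state_carrier: "state_mat d A \<Longrightarrow> A \<in> carrier_mat d d"
  by (simp add: state_mat_def psd_mat_def hermitian_mat_def)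

lemma state_kron:
  assumes "state_mat d1 A" "state_mat d2 B" "d2 > 0"
  shows "state_mat (d1 * d2) (kron A B)"
  using state_tens[OF pairing_div_mod[OF assms(3)] assms(1,2)]
    kron_eq_tens[OF state_carrier[OF assms(1)] state_carrier[OF assms(2)]] by simp

text \<open>A composite index over \<open>A\<^sub>1 A\<^sub>2 B\<^sub>1 B\<^sub>2\<close> splits into indices over \<open>A\<^sub>1 B\<^sub>1\<close> and \<open>A\<^sub>2 B\<^sub>2\<close>;
  as in \<^const>\<open>tensor_pow\<close>, the first factor holds the low-order digits.\<close>

definition lo_index :: "nat \<Rightarrow> nat \<Rightarrow> nat \<Rightarrow> nat \<Rightarrow> nat" where
  "lo_index a1 b1 b2 i = (i div (b1 * b2)) mod a1 * b1 + (i mod (b1 * b2)) mod b1"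

definition hi_index :: "nat \<Rightarrow> nat \<Rightarrow> nat \<Rightarrow> nat \<Rightarrow> nat" where
  "hi_index a1 b1 b2 i = (i div (b1 * b2)) div a1 * b2 + (i mod (b1 * b2)) div b1"

lemma lo_hi_index:
  assumes "b1 > 0" "b2 > 0"
  shows "lo_index a1 b1 b2 i div b1 = (i div (b1 * b2)) mod a1"
    "lo_index a1 b1 b2 i mod b1 = (i mod (b1 * b2)) mod b1"
    "hi_index a1 b1 b2 i div b2 = (i div (b1 * b2)) div a1"
    "hi_index a1 b1 b2 i mod b2 = (i mod (b1 * b2)) div b1"
proof -
  have lt: "i mod (b1 * b2) div b1 < b2"
    using assms by (simp add: less_mult_imp_div_less mult.commute)
  show "lo_index a1 b1 b2 i div b1 = (i div (b1 * b2)) mod a1"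
    "lo_index a1 b1 b2 i mod b1 = (i mod (b1 * b2)) mod b1"
    using assms by (simp_all add: lo_index_def)
  show "hi_index a1 b1 b2 i div b2 = (i div (b1 * b2)) div a1"
    "hi_index a1 b1 b2 i mod b2 = (i mod (b1 * b2)) div b1"
    using assms lt by (simp_all add: hi_index_def)
qed

lemma pairing_lo_hi:
  assumes "a1 > 0" "a2 > 0" "b1 > 0" "b2 > 0"
  shows "pairing (a1 * a2 * (b1 * b2)) (a1 * b1) (a2 * b2) (lo_index a1 b1 b2) (hi_index a1 b1 b2)"
proof (rule pairingI)
  show "inj_on (\<lambda>i. (lo_index a1 b1 b2 i, hi_index a1 b1 b2 i)) {..<a1 * a2 * (b1 * b2)}"
  proof (rule inj_onI)
    fix i j assume "(lo_index a1 b1 b2 i, hi_index a1 b1 b2 i) = (lo_index a1 b1 b2 j, hi_index a1 b1 b2 j)"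
    then have eq: "(i div (b1 * b2)) mod a1 = (j div (b1 * b2)) mod a1"
      "(i mod (b1 * b2)) mod b1 = (j mod (b1 * b2)) mod b1"
      "(i div (b1 * b2)) div a1 = (j div (b1 * b2)) div a1"
      "(i mod (b1 * b2)) div b1 = (j mod (b1 * b2)) div b1"
      using lo_hi_index[OF assms(3,4)] by (metis Pair_inject)+
    have "i div (b1 * b2) = j div (b1 * b2)" using eq(1,3) by (metis div_mult_mod_eq)
    moreover have "i mod (b1 * b2) = j mod (b1 * b2)" using eq(2,4) by (metis div_mult_mod_eq)
    ultimately show "i = j" by (metis div_mult_mod_eq)
  qed
next
  fix i assume i: "i < a1 * a2 * (b1 * b2)"
  have "lo_index a1 b1 b2 i div b1 < a1" using assms by (simp add: lo_hi_index)
  then show "lo_index a1 b1 b2 i < a1 * b1" using assms by (simp add: div_less_iff_less_mult)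
  have "i div (b1 * b2) < a1 * a2" using i by (simp add: less_mult_imp_div_less)
  then have "hi_index a1 b1 b2 i div b2 < a2"
    using assms by (simp add: lo_hi_index less_mult_imp_div_less mult.commute)
  then show "hi_index a1 b1 b2 i < a2 * b2" using assms by (simp add: div_less_iff_less_mult)
qed simp

definition tensAB :: "nat \<Rightarrow> nat \<Rightarrow> nat \<Rightarrow> nat \<Rightarrow> complex mat \<Rightarrow> complex mat \<Rightarrow> complex mat" where
  "tensAB dA dB n1 n2 = tens (dA ^ (n1 + n2) * dB ^ (n1 + n2))
     (lo_index (dA ^ n1) (dB ^ n1) (dB ^ n2)) (hi_index (dA ^ n1) (dB ^ n1) (dB ^ n2))"

lemma pairing_AB:
  assumes "dA > 0" "dB > 0"
  shows "pairing (dA ^ (n1 + n2) * dB ^ (n1 + n2)) (dA ^ n1 * dB ^ n1) (dA ^ n2 * dB ^ n2)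
     (lo_index (dA ^ n1) (dB ^ n1) (dB ^ n2)) (hi_index (dA ^ n1) (dB ^ n1) (dB ^ n2))"
  using pairing_lo_hi[of "dA ^ n1" "dA ^ n2" "dB ^ n1" "dB ^ n2"] assms by (simp add: power_add)

lemma digit_mod_power:
  assumes "k < n" "b > 0"
  shows "digit b k (x mod b ^ n) = digit b k x"
proof -
  have "n = k + (n - k)" using assms by simp
  then have n: "b ^ n = b ^ k * b ^ (n - k)" by (metis power_add)
  have "x mod b ^ n div b ^ k = x div b ^ k mod b ^ (n - k)"
    unfolding n mod_mult2_eq using assms by simp
  moreover have "b dvd b ^ (n - k)" using assms by simp
  ultimately show ?thesis by (simp add: digit_def mod_mod_cancel)
qed

lemma digit_div_power: "digit b k (x div b ^ n) = digit b (n + k) x"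
  by (simp add: digit_def power_add div_mult2_eq)

lemma prod_lessThan_add:
  fixes n1 n2 :: nat and f :: "nat \<Rightarrow> 'a :: comm_monoid_mult"
  shows "(\<Prod>k<n1 + n2. f k) = (\<Prod>k<n1. f k) * (\<Prod>k<n2. f (n1 + k))"
  by (induction n2) (auto simp: mult.assoc)

text \<open>The product over copies splits at \<open>n1\<close>: \<open>lo_index\<close> reads the
  \<open>n1\<close> low-order digits of the A and B parts of an index, \<open>hi_index\<close> the
  others.\<close>

lemma tensor_pow_add:
  assumes d: "dA > 0" "dB > 0"
  shows "tensor_pow dA dB (n1 + n2) R = tensAB dA dB n1 n2 (tensor_pow dA dB n1 R) (tensor_pow dA dB n2 R)"
proof (rule eq_matI)
  let ?N = "dA ^ (n1 + n2) * dB ^ (n1 + n2)"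
  let ?lo = "lo_index (dA ^ n1) (dB ^ n1) (dB ^ n2)"
  let ?hi = "hi_index (dA ^ n1) (dB ^ n1) (dB ^ n2)"
  let ?B = "dB ^ (n1 + n2)"
  fix i j assume "i < dim_row (tensAB dA dB n1 n2 (tensor_pow dA dB n1 R) (tensor_pow dA dB n2 R))"
    "j < dim_col (tensAB dA dB n1 n2 (tensor_pow dA dB n1 R) (tensor_pow dA dB n2 R))"
  then have ij: "i < ?N" "j < ?N" by (simp_all add: tensAB_def tens_def)
  note P = pairing_AB[OF d, of n1 n2]
  have pos: "dB ^ n1 > 0" "dB ^ n2 > 0" using d by auto
  have lo: "digit dA k (?lo i div dB ^ n1) = digit dA k (i div ?B)"
    "digit dB k (?lo i mod dB ^ n1) = digit dB k (i mod ?B)" if "k < n1" for k i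
    using that d by (simp_all add: lo_hi_index[OF pos] digit_mod_power flip: power_add)
  have hi: "digit dA k (?hi i div dB ^ n2) = digit dA (n1 + k) (i div ?B)"
    "digit dB k (?hi i mod dB ^ n2) = digit dB (n1 + k) (i mod ?B)" for k i
    by (simp_all add: lo_hi_index[OF pos] digit_div_power flip: power_add)
  have lt: "?lo i < dA ^ n1 * dB ^ n1" "?lo j < dA ^ n1 * dB ^ n1"
      "?hi i < dA ^ n2 * dB ^ n2" "?hi j < dA ^ n2 * dB ^ n2"
    using pairing_lt[OF P ij(1)] pairing_lt[OF P ij(2)] by auto
  show "tensor_pow dA dB (n1 + n2) R $$ (i,j)
    = tensAB dA dB n1 n2 (tensor_pow dA dB n1 R) (tensor_pow dA dB n2 R) $$ (i,j)"
    unfolding tensAB_def tens_def tensor_pow_def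
    using ij lt by (simp add: prod_lessThan_add lo hi)
qed (simp_all add: tensAB_def tens_def tensor_pow_def)

section \<open>Separable states\<close>

lemma mtrace_mat_combination:
  "mtrace (Matrix.mat d d (\<lambda>(r,c). \<Sum>i<m. f i * A i $$ (r,c))) = (\<Sum>i<m. f i * (\<Sum>r<d. A i $$ (r,r)))"
  by (simp add: mtrace_def sum_distrib_left sum.swap[of _ "{..<m}"])

lemma state_convex_combination:
  assumes p: "\<And>i. i < m \<Longrightarrow> p i \<ge> (0::real)" "(\<Sum>i<m. p i) = 1" and A: "\<And>i. i < m \<Longrightarrow> state_mat d (A i)"
  shows "state_mat d (Matrix.mat d d (\<lambda>(r,c). \<Sum>i<m. complex_of_real (p i) * A i $$ (r,c)))" (is "state_mat d ?S")
proof -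
  have c: "A i \<in> carrier_mat d d" if "i < m" for i using A[OF that] by (rule state_carrier)
  have "mtrace ?S = (\<Sum>i<m. of_real (p i) * mtrace (A i))"
    unfolding mtrace_mat_combination using c by (intro sum.cong refl) (auto simp: mtrace_def)
  also have "\<dots> = of_real (\<Sum>i<m. p i)"
    using A by (simp add: state_mat_def)
  finally have tr: "mtrace ?S = 1" using p by simp
  have h: "A i $$ (s,r) = cnj (A i $$ (r,s))" if "i < m" "r < d" "s < d" for i r s
    using A[OF that(1)] that unfolding state_mat_def psd_mat_iff hermitian_mat_iff by blast
  have "?S $$ (s,r) = cnj (?S $$ (r,s))" if "r < d" "s < d" for r s
  proof -
    have "(\<Sum>i<m. complex_of_real (p i) * A i $$ (s,r)) = (\<Sum>i<m. complex_of_real (p i) * cnj (A i $$ (r,s)))"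
      by (intro sum.cong refl arg_cong2[of _ _ _ _ "(*)"] h) (use that in auto)
    then show ?thesis using that by simp
  qed
  then have herm: "hermitian_mat d ?S" unfolding hermitian_mat_iff by auto
  have "qf d ?S x = (\<Sum>i<m. p i * qf d (A i) x)" for x
  proof -
    have "(\<Sum>a<d. \<Sum>b<d. cnj (x a) * ?S $$ (a,b) * x b)
        = (\<Sum>a<d. \<Sum>b<d. \<Sum>i<m. of_real (p i) * (cnj (x a) * A i $$ (a,b) * x b))"
      by (intro sum.cong refl) (simp add: sum_distrib_left sum_distrib_right mult_ac)
    also have "\<dots> = (\<Sum>i<m. of_real (p i) * (\<Sum>a<d. \<Sum>b<d. cnj (x a) * A i $$ (a,b) * x b))"
      unfolding sum_distrib_left by (subst (2) sum.swap, subst (1) sum.swap) (rule refl)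
    finally show ?thesis by (simp add: qf_def)
  qed
  moreover have "qf d (A i) x \<ge> 0" if "i < m" for i x
    using A[OF that] by (simp add: state_mat_def psd_mat_iff)
  ultimately have "psd_mat d ?S" unfolding psd_mat_iff using herm p by (auto intro!: sum_nonneg)
  then show ?thesis using tr by (simp add: state_mat_def)
qed

lemma separable_state:
  assumes "s \<in> separable_states dA dB n" "dB > 0"
  shows "state_mat (dA ^ n * dB ^ n) s"
proof -
  obtain m :: nat and p :: "nat \<Rightarrow> real" and A B where
    *: "\<forall>i<m. p i \<ge> 0 \<and> state_mat (dA ^ n) (A i) \<and> state_mat (dB ^ n) (B i)" "(\<Sum>i<m. p i) = 1"
    "s = Matrix.mat (dA ^ n * dB ^ n) (dA ^ n * dB ^ n) (\<lambda>(r,c). \<Sum>i<m. complex_of_real (p i) * kron (A i) (B i) $$ (r,c))"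
    using assms(1) unfolding separable_states_def by blast
  show ?thesis
    unfolding *(3) using * assms(2) by (intro state_convex_combination state_kron) auto
qed

definition maxmix :: "nat \<Rightarrow> complex mat" where
  "maxmix d = Matrix.mat d d (\<lambda>(a,b). of_bool (a = b) / of_nat d)"

lemma maxmix_state:
  assumes "d > 0"
  shows "state_mat d (maxmix d)"
proof -
  have o: "orthon d d (\<lambda>i a. of_bool (a = i))"
    unfolding orthon_def by (auto simp: cip_delta)
  have "(\<Sum>i<d. complex_of_real (1 / real d) * of_bool (a = i) * cnj (of_bool (b = i))) = of_bool (a = b) / of_nat d"
    if "a < d" "b < d" for a b
    using that by (subst sum.remove[of _ a]) auto
  then have "spec d (maxmix d) (\<lambda>i a. of_bool (a = i)) (\<lambda>i. 1 / real d)"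
    using orthon_imp_onb[OF o] by (simp add: spec_def maxmix_def)
  from spec_psd[OF this] show ?thesis
    using assms by (simp add: state_mat_def mtrace_def maxmix_def)
qed

lemma kron_maxmix:
  assumes "a > 0" "b > 0" "r < a * b" "c < a * b"
  shows "kron (maxmix a) (maxmix b) $$ (r,c) = of_bool (r = c) / of_nat (a * b)"
proof -
  have "r div b = c div b \<and> r mod b = c mod b \<longleftrightarrow> r = c" by (metis div_mult_mod_eq)
  moreover have "r div b < a" "c div b < a" using assms by (auto simp: less_mult_imp_div_less)
  ultimately show ?thesis using assms by (auto simp: kron_def maxmix_def)
qed

text \<open>I/D is the Kronecker product of the local maximally mixed states, so it enters the
  decomposition as one further product term, at position \<open>m\<close>, with weight 1/2.\<close>

lemma separable_depol:
  assumes s: "s \<in> separable_states dA dB n" and d: "dA > 0" "dB > 0"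
  shows "depol (dA ^ n * dB ^ n) s \<in> separable_states dA dB n"
proof -
  let ?N = "dA ^ n * dB ^ n"
  obtain m :: nat and p :: "nat \<Rightarrow> real" and A B where
    *: "\<forall>i<m. p i \<ge> 0 \<and> state_mat (dA ^ n) (A i) \<and> state_mat (dB ^ n) (B i)" "(\<Sum>i<m. p i) = 1"
    "s = Matrix.mat ?N ?N (\<lambda>(r,c). \<Sum>i<m. complex_of_real (p i) * kron (A i) (B i) $$ (r,c))"
    using s unfolding separable_states_def by blast
  define p' where "p' i = (if i < m then p i / 2 else 1 / 2)" for i
  define A' where "A' i = (if i < m then A i else maxmix (dA ^ n))" for i
  define B' where "B' i = (if i < m then B i else maxmix (dB ^ n))" for i
  have "\<forall>i<Suc m. p' i \<ge> 0 \<and> state_mat (dA ^ n) (A' i) \<and> state_mat (dB ^ n) (B' i)"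
    using * d by (auto simp: p'_def A'_def B'_def maxmix_state)
  moreover have "(\<Sum>i<Suc m. p' i) = 1"
    using *(2) by (simp add: p'_def sum_divide_distrib[symmetric])
  moreover have "depol ?N s
      = Matrix.mat ?N ?N (\<lambda>(r,c). \<Sum>i<Suc m. complex_of_real (p' i) * kron (A' i) (B' i) $$ (r,c))"
  proof (rule eq_matI; clarsimp)
    fix r c assume "r < ?N" "c < ?N"
    then show "depol ?N s $$ (r,c) = (\<Sum>i<m. complex_of_real (p' i) * kron (A' i) (B' i) $$ (r,c))
        + complex_of_real (p' m) * kron (A' m) (B' m) $$ (r,c)"
      using d by (simp add: depol_def *(3) p'_def A'_def B'_def kron_maxmix sum_divide_distrib add_divide_distrib)
  qed (simp_all add: depol_def)
  ultimately show ?thesis unfolding separable_states_def by blast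
qed

lemma separable_ex:
  assumes d: "dA > 0" "dB > 0"
  shows "\<exists>s. s \<in> separable_states dA dB n"
proof -
  let ?N = "dA ^ n * dB ^ n"
  define A B p where "A = (\<lambda>i::nat. maxmix (dA ^ n))" and "B = (\<lambda>i::nat. maxmix (dB ^ n))"
    and "p = (\<lambda>i::nat. 1 :: real)"
  have "(\<forall>i<1. p i \<ge> 0 \<and> state_mat (dA ^ n) (A i) \<and> state_mat (dB ^ n) (B i)) \<and> (\<Sum>i<1. p i) = 1"
    using d by (auto simp: A_def B_def p_def maxmix_state)
  then have "Matrix.mat ?N ?N (\<lambda>(r,c). \<Sum>i<1. complex_of_real (p i) * kron (A i) (B i) $$ (r,c))
      \<in> separable_states dA dB n"
    unfolding separable_states_def by blast
  then show ?thesis by blast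
qed

text \<open>Product terms multiply to product terms once copies are regrouped as A with A and B with
  B.\<close>

lemma separable_tens:
  assumes s: "s \<in> separable_states dA dB n1" and t: "t \<in> separable_states dA dB n2"
    and d: "dA > 0" "dB > 0"
  shows "tensAB dA dB n1 n2 s t \<in> separable_states dA dB (n1 + n2)"
proof -
  let ?N1 = "dA ^ n1 * dB ^ n1" and ?N2 = "dA ^ n2 * dB ^ n2"
  let ?N = "dA ^ (n1 + n2) * dB ^ (n1 + n2)"
  let ?lo = "lo_index (dA ^ n1) (dB ^ n1) (dB ^ n2)"
  let ?hi = "hi_index (dA ^ n1) (dB ^ n1) (dB ^ n2)"
  obtain m :: nat and p :: "nat \<Rightarrow> real" and A B where
    s: "\<forall>i<m. p i \<ge> 0 \<and> state_mat (dA ^ n1) (A i) \<and> state_mat (dB ^ n1) (B i)" "(\<Sum>i<m. p i) = 1"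
    "s = Matrix.mat ?N1 ?N1 (\<lambda>(r,c). \<Sum>i<m. complex_of_real (p i) * kron (A i) (B i) $$ (r,c))"
    using s unfolding separable_states_def by blast
  obtain l :: nat and q :: "nat \<Rightarrow> real" and A' B' where
    t: "\<forall>i<l. q i \<ge> 0 \<and> state_mat (dA ^ n2) (A' i) \<and> state_mat (dB ^ n2) (B' i)" "(\<Sum>i<l. q i) = 1"
    "t = Matrix.mat ?N2 ?N2 (\<lambda>(r,c). \<Sum>i<l. complex_of_real (q i) * kron (A' i) (B' i) $$ (r,c))"
    using t unfolding separable_states_def by blast
  have l: "l > 0" using t(2) by (cases l) auto
  note M = pairing_div_mod[OF l, of m]
  note P = pairing_AB[OF d, of n1 n2]
  have pos: "dB ^ n1 > 0" "dB ^ n2 > 0" "dA ^ n1 > 0" "dA ^ n2 > 0" using d by auto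
  define pr where "pr i = p (i div l) * q (i mod l)" for i
  \<comment> \<open>\<open>kron\<close> puts its second argument into the low-order digits, so the
    first factor of \<open>tensAB\<close> comes second here.\<close>
  define AA where "AA i = kron (A' (i mod l)) (A (i div l))" for i
  define BB where "BB i = kron (B' (i mod l)) (B (i div l))" for i
  have "\<forall>i<m * l. pr i \<ge> 0 \<and> state_mat (dA ^ (n1 + n2)) (AA i) \<and> state_mat (dB ^ (n1 + n2)) (BB i)"
  proof (intro allI impI)
    fix i assume "i < m * l"
    then have "i div l < m" "i mod l < l" using pairing_lt[OF M] by auto
    then show "pr i \<ge> 0 \<and> state_mat (dA ^ (n1 + n2)) (AA i) \<and> state_mat (dB ^ (n1 + n2)) (BB i)"
      using s(1) t(1) pos state_kron[of "dA ^ n2" "A' (i mod l)" "dA ^ n1" "A (i div l)"]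
        state_kron[of "dB ^ n2" "B' (i mod l)" "dB ^ n1" "B (i div l)"]
      by (auto simp: pr_def AA_def BB_def power_add mult.commute)
  qed
  moreover have "(\<Sum>i<m * l. pr i) = 1"
    unfolding pr_def pairing_sum_mult[OF M] s(2) t(2) by simp
  moreover have "tensAB dA dB n1 n2 s t
      = Matrix.mat ?N ?N (\<lambda>(r,c). \<Sum>i<m * l. complex_of_real (pr i) * kron (AA i) (BB i) $$ (r,c))"
    (is "?L = ?R")
  proof (rule eq_matI)
    fix r c assume "r < dim_row ?R" "c < dim_col ?R"
    then have rc: "r < ?N" "c < ?N" by auto
    have lt: "?lo r < ?N1" "?lo c < ?N1" "?hi r < ?N2" "?hi c < ?N2"
      using pairing_lt[OF P rc(1)] pairing_lt[OF P rc(2)] by auto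
    have K: "kron (A i) (B i) $$ (?lo r, ?lo c) * kron (A' j) (B' j) $$ (?hi r, ?hi c)
        = kron (kron (A' j) (A i)) (kron (B' j) (B i)) $$ (r,c)" if "i < m" "j < l" for i j
    proof -
      have c: "A i \<in> carrier_mat (dA ^ n1) (dA ^ n1)" "B i \<in> carrier_mat (dB ^ n1) (dB ^ n1)"
        "A' j \<in> carrier_mat (dA ^ n2) (dA ^ n2)" "B' j \<in> carrier_mat (dB ^ n2) (dB ^ n2)"
        using that s(1) t(1) state_carrier by blast+
      have "r div (dB ^ n1 * dB ^ n2) < dA ^ n1 * dA ^ n2" "c div (dB ^ n1 * dB ^ n2) < dA ^ n1 * dA ^ n2"
        using rc by (simp_all add: less_mult_imp_div_less power_add)
      then show ?thesis
        using rc lt c pos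
        by (simp add: kron_def lo_hi_index power_add mult.commute mult.left_commute)
    qed
    have "?L $$ (r,c) = s $$ (?lo r, ?lo c) * t $$ (?hi r, ?hi c)"
      using rc by (simp add: tensAB_def tens_def)
    also have "\<dots> = (\<Sum>i<m. of_real (p i) * kron (A i) (B i) $$ (?lo r, ?lo c))
        * (\<Sum>j<l. of_real (q j) * kron (A' j) (B' j) $$ (?hi r, ?hi c))"
      using lt by (simp add: s(3) t(3))
    also have "\<dots> = (\<Sum>i<m * l. (of_real (p (i div l)) * kron (A (i div l)) (B (i div l)) $$ (?lo r, ?lo c))
        * (of_real (q (i mod l)) * kron (A' (i mod l)) (B' (i mod l)) $$ (?hi r, ?hi c)))"
      by (rule pairing_sum_mult[OF M, symmetric])
    also have "\<dots> = (\<Sum>i<m * l. complex_of_real (pr i) * kron (AA i) (BB i) $$ (r,c))"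
    proof (intro sum.cong refl)
      fix i assume "i \<in> {..<m * l}"
      then have "i div l < m" "i mod l < l" using pairing_lt[OF M] by auto
      from K[OF this] show "(of_real (p (i div l)) * kron (A (i div l)) (B (i div l)) $$ (?lo r, ?lo c))
        * (of_real (q (i mod l)) * kron (A' (i mod l)) (B' (i mod l)) $$ (?hi r, ?hi c))
        = complex_of_real (pr i) * kron (AA i) (BB i) $$ (r,c)"
        by (simp add: pr_def AA_def BB_def mult_ac)
    qed
    finally show "?L $$ (r,c) = ?R $$ (r,c)" using rc by simp
  qed (simp_all add: tensAB_def tens_def)
  ultimately show ?thesis unfolding separable_states_def by blast
qed

section \<open>Asymptotic rates\<close>

lemma smooth_ball_mono: "e \<le> e' \<Longrightarrow> smooth_ball d e w \<subseteq> smooth_ball d e' w"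
  by (auto simp: smooth_ball_def)

lemma E_max_smooth_antimono: "e \<le> e' \<Longrightarrow> E_max_smooth dA dB n e' w \<le> E_max_smooth dA dB n e w"
  unfolding E_max_smooth_def D_max_smooth_def
  by (intro INF_mono' INF_superset_mono smooth_ball_mono order_refl)

lemma tensor_pow_0: "tensor_pow dA dB 0 R = maxmix 1"
  by (auto simp: tensor_pow_def maxmix_def)

lemma tensor_pow_1:
  assumes "R \<in> carrier_mat (dA * dB) (dA * dB)"
  shows "tensor_pow dA dB 1 R = R"
proof (rule eq_matI)
  fix i j assume "i < dim_row R" "j < dim_col R"
  then have ij: "i < dA * dB" "j < dA * dB" using assms by auto
  have "digit dA 0 (i div dB) * dB + digit dB 0 (i mod dB) = i" if "i < dA * dB" for i
    using that by (simp add: digit_def less_mult_imp_div_less)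
  then show "tensor_pow dA dB 1 R $$ (i,j) = R $$ (i,j)" using ij by (simp add: tensor_pow_def)
qed (use assms in \<open>auto simp: tensor_pow_def\<close>)

lemma tensor_pow_state:
  assumes d: "dA > 0" "dB > 0" and R: "state_mat (dA * dB) R"
  shows "state_mat (dA ^ n * dB ^ n) (tensor_pow dA dB n R)"
proof (induction n)
  case 0
  then show ?case using maxmix_state[of 1] by (simp add: tensor_pow_0)
next
  case (Suc n)
  have "state_mat (dA ^ 1 * dB ^ 1) (tensor_pow dA dB 1 R)"
    using R unfolding tensor_pow_1[OF state_carrier[OF R]] by simp
  from state_tens[OF pairing_AB[OF d] Suc this] show ?case
    using tensor_pow_add[OF d, of n 1 R] by (simp add: tensAB_def)
qed

text \<open>Only the statistics of a separable state against \<open>tensor_pow\<close> are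
  remembered; they add when blocks of copies are put side by side.\<close>

definition achievable :: "nat \<Rightarrow> nat \<Rightarrow> complex mat \<Rightarrow> nat \<Rightarrow> real \<Rightarrow> real \<Rightarrow> real \<Rightarrow> real \<Rightarrow> bool" where
  "achievable dA dB R n m1 v1 m2 v2 \<longleftrightarrow>
     (\<exists>s\<in>separable_states dA dB n. log_moments (dA ^ n * dB ^ n) (tensor_pow dA dB n R) s m1 v1 m2 v2)"

lemma achievable_add:
  assumes d: "dA > 0" "dB > 0"
    and "achievable dA dB R n m1 v1 m1' v1'" "achievable dA dB R k m2 v2 m2' v2'"
  shows "achievable dA dB R (n + k) (m1 + m2) (v1 + v2) (m1' + m2') (v1' + v2')"
proof -
  obtain s t where s: "s \<in> separable_states dA dB n"
      "log_moments (dA ^ n * dB ^ n) (tensor_pow dA dB n R) s m1 v1 m1' v1'"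
    and t: "t \<in> separable_states dA dB k" "log_moments (dA ^ k * dB ^ k) (tensor_pow dA dB k R) t m2 v2 m2' v2'"
    using assms(3,4) unfolding achievable_def by blast
  show ?thesis
    unfolding achievable_def
    using separable_tens[OF s(1) t(1) d] log_moments_tens[OF pairing_AB[OF d] s(2) t(2)] tensor_pow_add[OF d, of n k R]
    by (auto simp: tensAB_def)
qed

text \<open>Zero copies live in dimension 1, where both states have the single eigenvalue 1 and all
  logarithms vanish. This starts the induction in \<open>achievable_mult\<close>.\<close>

lemma achievable_0:
  assumes d: "dA > 0" "dB > 0"
  shows "achievable dA dB R 0 0 0 0 0"
proof -
  obtain s where s: "s \<in> separable_states dA dB 0" using separable_ex[OF d] by blast
  have w: "state_mat 1 (tensor_pow dA dB 0 R)" using maxmix_state[of 1] by (simp add: tensor_pow_0)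
  have s': "state_mat 1 s" using separable_state[OF s d(2)] by simp
  obtain u lam where W: "spec 1 (tensor_pow dA dB 0 R) u lam" "\<And>i. i < 1 \<Longrightarrow> lam i \<ge> 0" "(\<Sum>i<1. lam i) = 1"
    "\<And>i. i < 1 \<Longrightarrow> lam i \<le> 1" using state_spec[OF w] by blast
  obtain v mu where S: "spec 1 s v mu" "\<And>i. i < 1 \<Longrightarrow> mu i \<ge> 0" "(\<Sum>i<1. mu i) = 1"
    "\<And>i. i < 1 \<Longrightarrow> mu i \<le> 1" using state_spec[OF s'] by blast
  have "(\<Sum>j<1. qf 1 (tensor_pow dA dB 0 R) (v j)) = 1"
    using mtrace_onb[OF spec_carrier[OF W(1)] spec_onb[OF S(1)]] w by (simp add: state_mat_def)
  then have "log_moments 1 (tensor_pow dA dB 0 R) s 0 0 0 0"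
    unfolding log_moments_def
    using W(1,3) S(1,3)
    by (intro exI[of _ u] exI[of _ lam] exI[of _ v] exI[of _ mu]) (auto simp: moments_def log2_supp_def)
  then show ?thesis using s by (auto simp: achievable_def)
qed

lemma achievable_mult:
  assumes d: "dA > 0" "dB > 0" and a: "achievable dA dB R n m1 v1 m2 v2"
  shows "achievable dA dB R (k * n) (real k * m1) (real k * v1) (real k * m2) (real k * v2)"
proof (induction k)
  case 0
  then show ?case using achievable_0[OF d] by simp
next
  case (Suc k)
  from achievable_add[OF d a Suc] show ?case by (simp add: algebra_simps)
qed

lemma achievable_E_max_smooth:
  assumes "achievable dA dB R n m1 v1 m2 v2" and t: "t > 0" and e: "e > 0"
    and v: "v1 \<le> t\<^sup>2 * e\<^sup>2 / 8" "v2 \<le> t\<^sup>2 * e\<^sup>2 / 8"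
  shows "E_max_smooth dA dB n e (tensor_pow dA dB n R) \<le> ereal (m1 - m2 + 2 * t)"
proof -
  obtain s where s: "s \<in> separable_states dA dB n"
      "log_moments (dA ^ n * dB ^ n) (tensor_pow dA dB n R) s m1 v1 m2 v2"
    using assms(1) unfolding achievable_def by blast
  have "E_max_smooth dA dB n e (tensor_pow dA dB n R) \<le> D_max_smooth (dA ^ n * dB ^ n) e (tensor_pow dA dB n R) s"
    unfolding E_max_smooth_def by (rule INF_lower[OF s(1)])
  also have "\<dots> \<le> ereal (m1 - m2 + 2 * t)" by (rule log_moments_D_max_smooth[OF s(2) t e v])
  finally show ?thesis .
qed

lemma achievable_rel_entropy:
  assumes d: "dA > 0" "dB > 0" and R: "state_mat (dA * dB) R"
    and s: "s \<in> separable_states dA dB n" "rel_entropy (dA ^ n * dB ^ n) (tensor_pow dA dB n R) s < ereal x"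
  shows "\<exists>m1 v1 m2 v2. achievable dA dB R n m1 v1 m2 v2 \<and> m1 - m2 \<le> x + 1"
proof -
  let ?D = "dA ^ n * dB ^ n" and ?w = "tensor_pow dA dB n R"
  have D: "?D > 0" using d by simp
  have supp: "supp_le ?D ?w s" using s(2) by (auto simp: rel_entropy_def split: if_splits)
  obtain m1 v1 m2 v2 where g: "log_moments ?D ?w (depol ?D s) m1 v1 m2 v2" "ereal (m1 - m2) \<le> rel_entropy ?D ?w s + 1"
    using log_moments_depol[OF D tensor_pow_state[OF d R] separable_state[OF s(1) d(2)] supp] by blast
  have "achievable dA dB R n m1 v1 m2 v2"
    unfolding achievable_def using g(1) separable_depol[OF s(1) d] by blast
  moreover have "rel_entropy ?D ?w s + 1 \<le> ereal (x + 1)"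
    using s(2) by (cases "rel_entropy ?D ?w s") (auto simp: one_ereal_def)
  from order_trans[OF g(2) this] have "m1 - m2 \<le> x + 1" by simp
  ultimately show ?thesis by blast
qed

text \<open>Provides for the copies left over when \<open>n\<close> is not a multiple of the block
  length. Their number is bounded, so any finite moments will do.\<close>

lemma achievable_one_ex:
  assumes d: "dA > 0" "dB > 0" and R: "state_mat (dA * dB) R"
  shows "\<exists>m1 v1 m2 v2. achievable dA dB R 1 m1 v1 m2 v2"
proof -
  let ?D = "dA ^ 1 * dB ^ 1" and ?w = "tensor_pow dA dB 1 R"
  have D: "?D > 0" using d by simp
  note w = tensor_pow_state[OF d R, of 1]
  obtain s where s: "s \<in> separable_states dA dB 1" using separable_ex[OF d] by blast
  \<comment> \<open>This first mixing secures the support condition;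
    \<open>log_moments_depol\<close> then mixes a second time.\<close>
  note s' = separable_depol[OF s d]
  obtain v mu where S: "spec ?D s v mu" "\<And>i. i < ?D \<Longrightarrow> mu i \<ge> 0" "(\<Sum>i<?D. mu i) = 1"
    "\<And>i. i < ?D \<Longrightarrow> mu i \<le> 1" using state_spec[OF separable_state[OF s d(2)]] by blast
  have "supp_le ?D ?w (depol ?D s)"
    by (rule spec_pos_supp_le[OF depol_spec[OF S(1)]])
       (use S(2) D state_carrier[OF w] in \<open>auto intro!: add_nonneg_pos\<close>)
  from log_moments_depol[OF D w separable_state[OF s' d(2)] this]
  show ?thesis unfolding achievable_def using separable_depol[OF s' d] by blast
qed

section \<open>Comparison of the regularized rates\<close>

definition Emax_rate :: "nat \<Rightarrow> nat \<Rightarrow> complex mat \<Rightarrow> real \<Rightarrow> ereal" where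
  "Emax_rate dA dB R e = limsup (\<lambda>n. E_max_smooth dA dB n e (tensor_pow dA dB n R) / ereal (real n))"

definition ER_rate :: "nat \<Rightarrow> nat \<Rightarrow> complex mat \<Rightarrow> nat \<Rightarrow> ereal" where
  "ER_rate dA dB R n = E_R dA dB n (tensor_pow dA dB n R) / ereal (real n)"

lemma eventually_ge_linear:
  assumes "c > (0::real)"
  shows "\<forall>\<^sub>F n in sequentially. C \<le> c * real n"
proof -
  have "\<forall>\<^sub>F n in sequentially. n \<ge> nat \<lceil>C / c\<rceil>" by (rule eventually_ge_at_top)
  then show ?thesis
  proof (eventually_elim)
    case (elim n)
    then have "C / c \<le> real n" by linarith
    then show ?case using assms by (simp add: field_simps)
  qed
qed

text \<open>Split \<open>n = k * m + r\<close> copies into \<open>k\<close> blocks and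
  \<open>r\<close> single copies. The variance grows linearly in \<open>n\<close> while the
  permitted deviation is \<open>\<delta> * n\<close>, so Chebyshev's ratio falls below any multiple
  of e^2, and the bound is the same for every \<open>e\<close>.\<close>

lemma Emax_rate_le:
  assumes d: "dA > 0" "dB > 0" and R: "state_mat (dA * dB) R" and e: "e > 0" and m: "m > 0"
    and s: "s \<in> separable_states dA dB m" "rel_entropy (dA ^ m * dB ^ m) (tensor_pow dA dB m R) s < ereal x"
  shows "Emax_rate dA dB R e \<le> ereal ((x + 1) / real m)"
proof -
  define X where "X = x + 1"
  obtain m1 v1 m2 v2 where a: "achievable dA dB R m m1 v1 m2 v2" and mX: "m1 - m2 \<le> X"
    using achievable_rel_entropy[OF d R s] unfolding X_def by blast
  obtain c1 w1 c2 w2 where b: "achievable dA dB R 1 c1 w1 c2 w2" using achievable_one_ex[OF d R] by blast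
  have "Emax_rate dA dB R e \<le> ereal (X / real m) + ereal \<eta>" if \<eta>: "\<eta> > 0" for \<eta>
  proof -
    \<comment> \<open>Two thirds of \<open>\<eta>\<close> pay for the deviation \<open>2 * t\<close>
      with \<open>t = \<delta> * n\<close>, the last third for the boundary terms collected in
      \<open>K\<close>.\<close>
    define \<delta> where "\<delta> = \<eta> / 3"
    have \<delta>: "\<delta> > 0" using \<eta> by (simp add: \<delta>_def)
    define C where "C = \<bar>v1\<bar> + \<bar>w1\<bar> + \<bar>v2\<bar> + \<bar>w2\<bar>"
    define K where "K = \<bar>X\<bar> + real m * \<bar>c1 - c2\<bar>"
    have ev1: "\<forall>\<^sub>F n in sequentially. C \<le> (\<delta>\<^sup>2 * e\<^sup>2 / 8) * real n"
      using \<delta> e by (intro eventually_ge_linear) simp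
    have ev2: "\<forall>\<^sub>F n in sequentially. K \<le> \<delta> * real n" by (rule eventually_ge_linear[OF \<delta>])
    have "\<forall>\<^sub>F n in sequentially. E_max_smooth dA dB n e (tensor_pow dA dB n R) / ereal (real n)
        \<le> ereal (X / real m + \<eta>)"
      using ev1 ev2 eventually_gt_at_top[of 0]
    proof eventually_elim
      case (elim n)
      define k r where "k = n div m" and "r = n mod m"
      have n: "n = k * m + r * 1" by (simp add: k_def r_def)
      have kr: "real k \<le> real n" "real r \<le> real n" "real r \<le> real m"
        using m by (auto simp: k_def r_def less_imp_le)
      have t: "\<delta> * real n > 0" using \<delta> elim(3) by simp
      have ach: "achievable dA dB R n (real k * m1 + real r * c1) (real k * v1 + real r * w1)
          (real k * m2 + real r * c2) (real k * v2 + real r * w2)"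
        unfolding n by (rule achievable_add[OF d achievable_mult[OF d a] achievable_mult[OF d b]])
      have vb: "real k * v + real r * w \<le> (\<delta> * real n)\<^sup>2 * e\<^sup>2 / 8" if "\<bar>v\<bar> + \<bar>w\<bar> \<le> C" for v w
      proof -
        have "real k * v + real r * w \<le> real n * \<bar>v\<bar> + real n * \<bar>w\<bar>"
          using mult_left_mono[OF abs_ge_self[of v], of "real k"] mult_right_mono[OF kr(1), of "\<bar>v\<bar>"]
            mult_left_mono[OF abs_ge_self[of w], of "real r"] mult_right_mono[OF kr(2), of "\<bar>w\<bar>"] by simp
        also have "\<dots> \<le> real n * C" using that by (simp flip: distrib_left add: mult_left_mono)
        also have "\<dots> \<le> real n * ((\<delta>\<^sup>2 * e\<^sup>2 / 8) * real n)" using elim(1) by (intro mult_left_mono) auto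
        also have "\<dots> = (\<delta> * real n)\<^sup>2 * e\<^sup>2 / 8" by (simp add: power2_eq_square)
        finally show ?thesis .
      qed
      have E: "E_max_smooth dA dB n e (tensor_pow dA dB n R)
          \<le> ereal ((real k * m1 + real r * c1) - (real k * m2 + real r * c2) + 2 * (\<delta> * real n))"
        by (rule achievable_E_max_smooth[OF ach t e]) (rule vb, simp add: C_def)+
      have "(real k * m1 + real r * c1) - (real k * m2 + real r * c2) + 2 * (\<delta> * real n)
          \<le> real n * (X / real m + \<eta>)"
      proof -
        have "real k * (m1 - m2) \<le> real k * X" using mX by (intro mult_left_mono) auto
        also have "real k * X = real n * (X / real m) - real r / real m * X"
        proof -
          have "real n = real k * real m + real r" using n by (metis of_nat_add of_nat_mult mult.right_neutral)
          then show ?thesis using m by (simp add: field_simps)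
        qed
        also have "\<dots> \<le> real n * (X / real m) + \<bar>X\<bar>"
        proof -
          have "\<bar>real r / real m * X\<bar> \<le> 1 * \<bar>X\<bar>"
            unfolding abs_mult using kr m by (intro mult_right_mono) auto
          then show ?thesis by linarith
        qed
        finally have 1: "real k * (m1 - m2) \<le> real n * (X / real m) + \<bar>X\<bar>" .
        have "real r * (c1 - c2) \<le> real r * \<bar>c1 - c2\<bar>" by (intro mult_left_mono) auto
        also have "\<dots> \<le> real m * \<bar>c1 - c2\<bar>" using kr by (intro mult_right_mono) auto
        finally have 2: "real r * (c1 - c2) \<le> real m * \<bar>c1 - c2\<bar>" .
        have "real n * \<eta> = 3 * (\<delta> * real n)" by (simp add: \<delta>_def)
        then show ?thesis using 1 2 elim(2) unfolding K_def distrib_left right_diff_distrib by linarith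
      qed
      then have "E_max_smooth dA dB n e (tensor_pow dA dB n R) \<le> ereal (real n * (X / real m + \<eta>))"
        using E by (meson ereal_less_eq(3) order_trans)
      then have "E_max_smooth dA dB n e (tensor_pow dA dB n R) / ereal (real n)
          \<le> ereal (real n * (X / real m + \<eta>)) / ereal (real n)"
        using elim(3) by (intro ereal_divide_right_mono) auto
      then show ?case using elim(3) by simp
    qed
    then have "Emax_rate dA dB R e \<le> ereal (X / real m + \<eta>)"
      unfolding Emax_rate_def by (rule Limsup_bounded)
    then show ?thesis by simp
  qed
  then show ?thesis unfolding X_def[symmetric] by (rule ereal_le_epsilon2)
qed

text \<open>The loss in \<open>rel_entropy_depol_le\<close> is uniform in \<open>s\<close>,
  \<open>wb\<close> and \<open>l\<close>; it is moved to the left before the three nested infima are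
  taken.\<close>

lemma E_R_le_E_max_smooth:
  assumes d: "dA > 0" "dB > 0" and R: "state_mat (dA * dB) R" and e: "0 \<le> e" "e \<le> 1/2"
  shows "E_R dA dB n (tensor_pow dA dB n R) \<le> E_max_smooth dA dB n e (tensor_pow dA dB n R)
    + ereal (2 * e * (1 + real n * log 2 (real (dA * dB))) + 3)"
proof -
  let ?D = "dA ^ n * dB ^ n" and ?w = "tensor_pow dA dB n R"
  let ?c = "2 * e * log 2 (2 * real ?D) + 3"
  have D: "?D > 0" using d by simp
  have "E_R dA dB n ?w - ereal ?c \<le> ereal (log 2 l)"
    if s: "s \<in> separable_states dA dB n" and wb: "wb \<in> smooth_ball ?D e ?w"
      and l: "l > 0" "mat_le ?D wb (complex_of_real l \<cdot>\<^sub>m s)" for s wb l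
  proof -
    have "E_R dA dB n ?w \<le> rel_entropy ?D ?w (depol ?D s)"
      unfolding E_R_def by (rule INF_lower[OF separable_depol[OF s d]])
    also have "\<dots> \<le> ereal (log 2 l + 2 * e * log 2 (2 * real ?D) + 3)"
      by (rule rel_entropy_depol_le[OF D tensor_pow_state[OF d R] separable_state[OF s d(2)] wb l(2,1) e])
    finally show ?thesis by (simp add: ereal_minus_le add.assoc)
  qed
  then have "E_R dA dB n ?w - ereal ?c \<le> E_max_smooth dA dB n e ?w"
    unfolding E_max_smooth_def D_max_smooth_def D_max_def by (intro INF_greatest) blast
  then have "E_R dA dB n ?w \<le> E_max_smooth dA dB n e ?w + ereal ?c" by (simp add: ereal_minus_le)
  moreover have "log 2 (2 * real ?D) = 1 + real n * log 2 (real (dA * dB))"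
    using d by (simp add: log_mult log_nat_power distrib_left flip: power_mult_distrib)
  ultimately show ?thesis by simp
qed

lemma ereal_add_divide_real: "n > 0 \<Longrightarrow> (a + ereal c) / ereal n = a / ereal n + ereal (c / n)"
  by (cases a) (auto simp: add_divide_distrib)

text \<open>Per copy the loss tends to 2 e log(dA dB). The summand 1 in the bound makes room for the
  constant \<open>2 * e + 3\<close>, which is eventually at most \<open>e * n\<close>.\<close>

lemma limsup_ER_rate_le:
  assumes d: "dA > 0" "dB > 0" and R: "state_mat (dA * dB) R" and e: "0 < e" "e \<le> 1/2"
  shows "limsup (ER_rate dA dB R) \<le> Emax_rate dA dB R e + ereal (e * (2 * log 2 (real (dA * dB)) + 1))"
proof -
  let ?L = "log 2 (real (dA * dB))"
  have "\<forall>\<^sub>F n in sequentially. 2 * e + 3 \<le> e * real n" by (rule eventually_ge_linear[OF e(1)])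
  then have "\<forall>\<^sub>F n in sequentially. ER_rate dA dB R n
      \<le> E_max_smooth dA dB n e (tensor_pow dA dB n R) / ereal (real n) + ereal (e * (2 * ?L + 1))"
    using eventually_gt_at_top[of 0]
  proof eventually_elim
    case (elim n)
    have "ER_rate dA dB R n \<le> (E_max_smooth dA dB n e (tensor_pow dA dB n R)
        + ereal (2 * e * (1 + real n * ?L) + 3)) / ereal (real n)"
      unfolding ER_rate_def using E_R_le_E_max_smooth[OF d R, of e n] e elim(2)
      by (intro ereal_divide_right_mono) auto
    also have "\<dots> = E_max_smooth dA dB n e (tensor_pow dA dB n R) / ereal (real n)
        + ereal ((2 * e * (1 + real n * ?L) + 3) / real n)"
      using elim(2) by (intro ereal_add_divide_real) simp
    also have "\<dots> \<le> E_max_smooth dA dB n e (tensor_pow dA dB n R) / ereal (real n) + ereal (e * (2 * ?L + 1))"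
    proof (intro add_left_mono)
      have "2 * e * (1 + real n * ?L) + 3 \<le> (e * (2 * ?L + 1)) * real n"
        using elim(1) by (simp add: algebra_simps)
      then show "ereal ((2 * e * (1 + real n * ?L) + 3) / real n) \<le> ereal (e * (2 * ?L + 1))"
        using elim(2) by (simp add: pos_divide_le_eq)
    qed
    finally show ?case .
  qed
  then have "limsup (ER_rate dA dB R) \<le> limsup (\<lambda>n. E_max_smooth dA dB n e (tensor_pow dA dB n R) / ereal (real n)
      + ereal (e * (2 * ?L + 1)))"
    by (rule Limsup_mono)
  also have "\<dots> = Emax_rate dA dB R e + ereal (e * (2 * ?L + 1))"
    unfolding Emax_rate_def by (intro Limsup_add_ereal_right) auto
  finally show ?thesis .
qed

lemma Emax_rate_antimono: "e \<le> e' \<Longrightarrow> Emax_rate dA dB R e' \<le> Emax_rate dA dB R e"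
  unfolding Emax_rate_def
  by (intro Limsup_mono eventually_mono[OF eventually_gt_at_top[of 0]])
     (auto intro!: ereal_divide_right_mono E_max_smooth_antimono)

theorem theorem1:
  fixes dA dB :: nat and \<rho> :: "complex mat"
  assumes "dA \<ge> 1" and "dB \<ge> 1"
    and "state_mat (dA * dB) \<rho>"
  shows "\<exists>L :: ereal.
     ((\<lambda>\<epsilon>. limsup (\<lambda>n. E_max_smooth dA dB n \<epsilon> (tensor_pow dA dB n \<rho>) / ereal (real n)))
        \<longlongrightarrow> L) (at_right 0)
   \<and> ((\<lambda>n. E_R dA dB n (tensor_pow dA dB n \<rho>) / ereal (real n)) \<longlongrightarrow> L) sequentially"
proof -
  have d: "dA > 0" "dB > 0" using assms by auto
  note R = assms(3)
  let ?F = "Emax_rate dA dB \<rho>" and ?a = "ER_rate dA dB \<rho>"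
  \<comment> \<open>The rates increase as the smoothing parameter decreases, so the right limit at 0
    is this supremum, taken in the extended reals before any finiteness is known.\<close>
  define L where "L = (SUP e\<in>{0<..}. ?F e)"
  have F_le: "?F e \<le> L" if "e > 0" for e unfolding L_def using that by (intro SUP_upper) simp
  have "(?F \<longlongrightarrow> L) (at_right 0)"
  proof (rule order_tendstoI)
    fix l assume "l < L"
    then obtain e0 where e0: "e0 > 0" "l < ?F e0" unfolding L_def less_SUP_iff by auto
    have "l < ?F e" if "e \<in> {0<..<e0}" for e
      using e0(2) Emax_rate_antimono[of e e0 dA dB \<rho>] that by (auto intro: less_le_trans)
    then show "\<forall>\<^sub>F e in at_right 0. l < ?F e"
      using e0(1) by (auto simp: eventually_at_right_field intro!: exI[of _ e0])
  next
    fix l assume "L < l"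
    then show "\<forall>\<^sub>F e in at_right 0. ?F e < l"
      using F_le by (auto simp: eventually_at_right_field intro!: exI[of _ 1] intro: le_less_trans)
  qed
  moreover have "limsup ?a \<le> L"
  proof (rule ereal_le_epsilon2)
    fix \<eta> :: real assume \<eta>: "\<eta> > 0"
    define c where "c = 2 * log 2 (real (dA * dB)) + 1"
    have "dA * dB \<ge> 1" using d by (simp add: Suc_le_eq)
    then have "real (dA * dB) \<ge> 1" by linarith
    then have c: "c > 0" by (simp add: c_def add_nonneg_pos)
    \<comment> \<open>The cap 1/2 is what \<open>limsup_ER_rate_le\<close> demands; the other bound
      keeps the loss \<open>e * c\<close> below \<open>\<eta>\<close>.\<close>
    define e where "e = min (1/2) (\<eta> / c)"
    have e: "0 < e" "e \<le> 1/2" "e * c \<le> \<eta>" using \<eta> c by (auto simp: e_def min_def field_simps)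
    have "limsup ?a \<le> ?F e + ereal (e * c)"
      unfolding c_def by (rule limsup_ER_rate_le[OF d R e(1,2)])
    also have "\<dots> \<le> L + ereal \<eta>" using F_le[OF e(1)] e(3) by (intro add_mono) auto
    finally show "limsup ?a \<le> L + ereal \<eta>" .
  qed
  moreover have "L \<le> liminf ?a"
  proof (rule ccontr)
    assume "\<not> L \<le> liminf ?a"
    then have "liminf ?a < L" by simp
    then obtain z where z: "liminf ?a < ereal z" "ereal z < L" using ereal_dense2 by blast
    \<comment> \<open>The gap between \<open>y\<close> and \<open>z\<close> absorbs the 1/n in
      \<open>Emax_rate_le\<close>. A single large block length with rate below \<open>y\<close>
      suffices, and the small liminf provides infinitely many.\<close>
    obtain y where y: "liminf ?a < ereal y" "ereal y < ereal z" using ereal_dense2[OF z(1)] by blast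
    have "\<not> (\<forall>\<^sub>F n in sequentially. ereal y \<le> ?a n)"
      using Liminf_bounded[of "ereal y" ?a sequentially] y(1) by auto
    then have "\<exists>\<^sub>F n in sequentially. \<not> ereal y \<le> ?a n" by (simp add: not_eventually)
    moreover have "\<forall>\<^sub>F n in sequentially. 1 \<le> (z - y) * real n" using y(2) by (intro eventually_ge_linear) simp
    ultimately have "\<exists>\<^sub>F n in sequentially. 1 \<le> (z - y) * real n \<and> \<not> ereal y \<le> ?a n"
      by (rule frequently_eventually_conj)
    from frequently_ex[OF this] obtain n where n: "?a n < ereal y" "1 \<le> (z - y) * real n"
      by (auto simp: not_le)
    have npos: "n > 0" using n(2) by (cases n) auto
    have "E_R dA dB n (tensor_pow dA dB n \<rho>) < ereal (y * real n)"
      using n(1) npos unfolding ER_rate_def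
      by (cases "E_R dA dB n (tensor_pow dA dB n \<rho>)") (auto simp: pos_divide_less_eq)
    then obtain s where s: "s \<in> separable_states dA dB n"
      "rel_entropy (dA ^ n * dB ^ n) (tensor_pow dA dB n \<rho>) s < ereal (y * real n)"
      unfolding E_R_def INF_less_iff by blast
    have "?F e \<le> ereal z" if "e > 0" for e
    proof -
      have "?F e \<le> ereal ((y * real n + 1) / real n)" by (rule Emax_rate_le[OF d R that npos s])
      also have "\<dots> \<le> ereal z" using n(2) npos by (simp add: field_simps)
      finally show ?thesis .
    qed
    then have "L \<le> ereal z" unfolding L_def by (intro SUP_least) simp
    then show False using z(2) by simp
  qed
  ultimately have "(?F \<longlongrightarrow> L) (at_right 0)" "limsup ?a \<le> L" "L \<le> liminf ?a" by blast+
  moreover have "liminf ?a \<le> limsup ?a" by (rule Liminf_le_Limsup) simp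
  ultimately have "(?F \<longlongrightarrow> L) (at_right 0)" "(?a \<longlongrightarrow> L) sequentially"
    by (auto intro!: Liminf_eq_Limsup)
  then show ?thesis unfolding Emax_rate_def ER_rate_def by blast
qed

end
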